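(* Suppose the ABC assumption (with constants $C,D\ge 0$) and the smoothness assumption (with constant $L$) hold, and let $\{x_t\}_{t\ge0}$ be generated by FedAvg with positive stepsizes $\{\alpha_t\}_{t\ge0}$ satisfying $$\alpha_t\le\min\left\{\frac1C,\ \frac{1}{2QL\sqrt3},\ \frac{1}{2\sqrt{2QCL}}\right\}\ \ \forall t,\qquad \sum_{t=0}^\infty\alpha_t=\infty,\qquad \sum_{t=0}^\infty\alpha_t^2<\infty.$$ Then $\lim_{t\to\infty}\mathbb{E}[\|\nabla f(x_t)\|]=0$, and $\lim_{t\to\infty}\|\nabla f(x_t)\|=0$ almost surely.
   Context: Setting: $n,p,Q\ge 1$ are integers, $[n]=\{1,\ldots,n\}$, $f_i:\mathbb{R}^p\to\mathbb{R}$ for $i\in[n]$, and $f=\frac1n\sum_{i=1}^n f_i$. Notation: $f_i^*:=\inf_x f_i(x)$; $\|\cdot\|$ is the Euclidean norm. FedAvg: given $x_0\in\mathbb{R}^p$, number of local updates $Q$, and positive stepsizes $\{\alpha_t\}$, in round $t=0,1,\ldots$ (run indefinitely) each agent $i\in[n]$ sets $x_{i,t}^0=x_t$ and performs, for $\ell=0,\ldots,Q-1$, $x_{i,t}^{\ell+1}=x_{i,t}^\ell-\alpha_t g_i(x_{i,t}^\ell;\xi_{i,t}^\ell)$, where $g_i(x_{i,t}^\ell;\xi_{i,t}^\ell)$ is a stochastic gradient; then $x_{t+1}=\frac1n\sum_{i=1}^n x_{i,t}^Q$. Smoothness assumption: each $f_i$ is $L$-smooth, i.e. $\|\nabla f_i(x)-\nabla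 f_i(x')\|\le L\|x-x'\|$ for all $x,x'\in\mathbb{R}^p$, and bounded from below, $f_i(x)\ge f_i^*>-\infty$. ABC assumption: there is a filtration $\mathcal{F}_0^0\subset\mathcal{F}_0^1\subset\cdots\subset\mathcal{F}_0^{Q-1}\subset\mathcal{F}_1^0\subset\mathcal{F}_1^1\subset\cdots$ (write $\mathcal{F}_k:=\mathcal{F}_k^0$) to which the process $\{x_{i,k}^\ell: i\in[n],\ 0\le\ell\le Q-1\}$ is adapted, and each $g_i(x_{i,k}^\ell;\xi_{i,k}^\ell)$ is $\mathcal{F}_{k+1}^\ell$-measurable. There are constants $C,D\ge0$ such that for all $k\in\mathbb{N}$, $i\in[n]$, $\ell\in\{0,\ldots,Q-1\}$, almost surely $\mathbb{E}[g_i(x;\xi_{i,k}^\ell)\mid\mathcal{F}_k^\ell]=\nabla f_i(x)$ and $\mathbb{E}[\|g_i(x;\xi_{i,k}^\ell)-\nabla f_i(x)\|^2\mid\mathcal{F}_k^\ell]\le C[f_i(x)-f_i^*]+D$ (applied in particular at $x=x_{i,k}^\ell$). In addition, the stochastic gradients are independent across different agents at each $k\ge0$. Convention: expressions such as $1/C$ are read as $+\infty$ when $C=0$. *)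

theory Defs
  imports "HOL-Probability.Probability"
begin

section \<open>Smooth objectives\<close>

text \<open>Only meaningful where \<open>f\<close> is differentiable.\<close>

definition gradient :: "('a::real_inner \<Rightarrow> real) \<Rightarrow> 'a \<Rightarrow> 'a" where
  "gradient f x = (THE D. GDERIV f x :> D)"

definition L_smooth :: "real \<Rightarrow> ('a::real_inner \<Rightarrow> real) \<Rightarrow> bool" where
  "L_smooth L f \<longleftrightarrow>
     (\<forall>x. f differentiable (at x)) \<and>
     (\<forall>x x'. norm (gradient f x - gradient f x') \<le> L * norm (x - x'))"

text \<open>The infimum is taken in the conditionally complete lattice of the reals, so it is
  meaningful only for functions that are bounded from below.\<close>

definition inf_val :: "('a \<Rightarrow> real) \<Rightarrow> real" where
  "inf_val f = (INF x. f x)"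

definition avg_fun :: "nat \<Rightarrow> (nat \<Rightarrow> 'a \<Rightarrow> real) \<Rightarrow> 'a \<Rightarrow> real" where
  "avg_fun n f x = (1 / real n) * (\<Sum>i = 1..n. f i x)"

section \<open>The algorithm\<close>

text \<open>Here \<open>g i x s\<close> is the stochastic gradient of agent \<open>i\<close> at the point \<open>x\<close> with sample \<open>s\<close>, and
  \<open>\<xi> i t l\<close> is the random sample drawn by agent \<open>i\<close> in local step \<open>l\<close> of round \<open>t\<close>. The function
  \<open>local_steps\<close> runs the first \<open>l\<close> local steps of round \<open>t\<close> from the starting point \<open>y\<close>, for a
  fixed outcome \<open>\<omega>\<close>.\<close>

primrec local_steps ::
  "(nat \<Rightarrow> 'a::real_normed_vector \<Rightarrow> 's \<Rightarrow> 'a) \<Rightarrow> (nat \<Rightarrow> nat \<Rightarrow> nat \<Rightarrow> 'w \<Rightarrow> 's) \<Rightarrow> (nat \<Rightarrow> real)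
   \<Rightarrow> nat \<Rightarrow> nat \<Rightarrow> 'w \<Rightarrow> 'a \<Rightarrow> nat \<Rightarrow> 'a" where
  "local_steps g \<xi> \<alpha> i t \<omega> y 0 = y"
| "local_steps g \<xi> \<alpha> i t \<omega> y (Suc l) =
     local_steps g \<xi> \<alpha> i t \<omega> y l
       - \<alpha> t *\<^sub>R g i (local_steps g \<xi> \<alpha> i t \<omega> y l) (\<xi> i t l \<omega>)"

primrec fedavg ::
  "nat \<Rightarrow> nat \<Rightarrow> (nat \<Rightarrow> 'a::real_normed_vector \<Rightarrow> 's \<Rightarrow> 'a) \<Rightarrow> (nat \<Rightarrow> nat \<Rightarrow> nat \<Rightarrow> 'w \<Rightarrow> 's)
   \<Rightarrow> (nat \<Rightarrow> real) \<Rightarrow> 'a \<Rightarrow> nat \<Rightarrow> 'w \<Rightarrow> 'a" where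
  "fedavg n Q g \<xi> \<alpha> x0 0 \<omega> = x0"
| "fedavg n Q g \<xi> \<alpha> x0 (Suc t) \<omega> =
     (1 / real n) *\<^sub>R
       (\<Sum>i = 1..n. local_steps g \<xi> \<alpha> i t \<omega> (fedavg n Q g \<xi> \<alpha> x0 t \<omega>) Q)"

definition local_iterate ::
  "nat \<Rightarrow> nat \<Rightarrow> (nat \<Rightarrow> 'a::real_normed_vector \<Rightarrow> 's \<Rightarrow> 'a) \<Rightarrow> (nat \<Rightarrow> nat \<Rightarrow> nat \<Rightarrow> 'w \<Rightarrow> 's)
   \<Rightarrow> (nat \<Rightarrow> real) \<Rightarrow> 'a \<Rightarrow> nat \<Rightarrow> nat \<Rightarrow> nat \<Rightarrow> 'w \<Rightarrow> 'a" where
  "local_iterate n Q g \<xi> \<alpha> x0 i t l \<omega> =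
     local_steps g \<xi> \<alpha> i t \<omega> (fedavg n Q g \<xi> \<alpha> x0 t \<omega>) l"

definition stoch_grad ::
  "nat \<Rightarrow> nat \<Rightarrow> (nat \<Rightarrow> 'a::real_normed_vector \<Rightarrow> 's \<Rightarrow> 'a) \<Rightarrow> (nat \<Rightarrow> nat \<Rightarrow> nat \<Rightarrow> 'w \<Rightarrow> 's)
   \<Rightarrow> (nat \<Rightarrow> real) \<Rightarrow> 'a \<Rightarrow> nat \<Rightarrow> nat \<Rightarrow> nat \<Rightarrow> 'w \<Rightarrow> 'a" where
  "stoch_grad n Q g \<xi> \<alpha> x0 i t l \<omega> =
     g i (local_iterate n Q g \<xi> \<alpha> x0 i t l \<omega>) (\<xi> i t l \<omega>)"

section \<open>Conditional expectation and conditional independence\<close>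

text \<open>The library has conditional expectations of real-valued functions only; vectors are treated
  componentwise.\<close>

definition vec_cond_exp ::
  "'w measure \<Rightarrow> 'w measure \<Rightarrow> ('w \<Rightarrow> real ^ 'p) \<Rightarrow> 'w \<Rightarrow> real ^ 'p" where
  "vec_cond_exp M F X \<omega> = (\<chi> j. real_cond_exp M F (\<lambda>\<omega>'. X \<omega>' $ j) \<omega>)"

text \<open>For a finite set \<open>I\<close>: \<open>P(\<forall>i\<in>I. X i \<in> A i | F) = (\<Prod>i\<in>I. P(X i \<in> A i | F))\<close> almost surely. Taking
  some of the \<open>A i\<close> to be the whole space gives the product formula for subsets of \<open>I\<close>.\<close>

definition cond_indep_vars ::
  "'w measure \<Rightarrow> 'w measure \<Rightarrow> 'b measure \<Rightarrow> ('i \<Rightarrow> 'w \<Rightarrow> 'b) \<Rightarrow> 'i set \<Rightarrow> bool" where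
  "cond_indep_vars M F N X I \<longleftrightarrow>
     (\<forall>A. (\<forall>i\<in>I. A i \<in> sets N) \<longrightarrow>
        (AE \<omega> in M.
           real_cond_exp M F (indicator {\<omega>' \<in> space M. \<forall>i\<in>I. X i \<omega>' \<in> A i}) \<omega>
           = (\<Prod>i\<in>I. real_cond_exp M F (indicator {\<omega>' \<in> space M. X i \<omega>' \<in> A i}) \<omega>)))"

section \<open>The ABC assumption\<close>

text \<open>\<open>G\<close> is the stochastic gradient of \<open>f\<close> taken at the (possibly random) point \<open>X\<close>. The
  second moment is a conditional expectation in the extended nonnegative reals, so the bound also
  says that it is finite and no integrability has to be assumed for it. Together with the bound,
  integrability of \<open>f \<circ> X\<close> and of \<open>gradient f \<circ> X\<close> makes \<open>G\<close> integrable, so that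
  \<open>vec_cond_exp\<close> is then the usual conditional expectation of \<open>G\<close>.\<close>

definition abc_at ::
  "'w measure \<Rightarrow> 'w measure \<Rightarrow> real \<Rightarrow> real \<Rightarrow> (real ^ 'p \<Rightarrow> real)
   \<Rightarrow> ('w \<Rightarrow> real ^ 'p) \<Rightarrow> ('w \<Rightarrow> real ^ 'p) \<Rightarrow> bool" where
  "abc_at M F C D f X G \<longleftrightarrow>
     (AE \<omega> in M. vec_cond_exp M F G \<omega> = gradient f (X \<omega>)) \<and>
     (AE \<omega> in M. nn_cond_exp M F (\<lambda>\<omega>'. ennreal ((norm (G \<omega>' - gradient f (X \<omega>')))\<^sup>2)) \<omega>
                   \<le> ennreal (C * (f (X \<omega>) - inf_val f) + D))"

text \<open>\<open>F k l\<close> is used only for \<open>l < Q\<close>. The moment conditions are imposed at every deterministic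
  point \<open>x\<close> and at the iterates. The stochastic gradients of one local step are independent across
  agents conditionally on the past \<open>F k l\<close>: unconditionally they are dependent in general,
  because all agents start a round from the same random point.\<close>

definition ABC_assumption ::
  "'w measure \<Rightarrow> (nat \<Rightarrow> nat \<Rightarrow> 'w measure) \<Rightarrow> real \<Rightarrow> real \<Rightarrow> nat \<Rightarrow> nat
   \<Rightarrow> (nat \<Rightarrow> real ^ 'p \<Rightarrow> real) \<Rightarrow> (nat \<Rightarrow> real ^ 'p \<Rightarrow> 's \<Rightarrow> real ^ 'p)
   \<Rightarrow> (nat \<Rightarrow> nat \<Rightarrow> nat \<Rightarrow> 'w \<Rightarrow> 's) \<Rightarrow> (nat \<Rightarrow> real) \<Rightarrow> real ^ 'p \<Rightarrow> bool" where
  "ABC_assumption M F C D n Q f g \<xi> \<alpha> x0 \<longleftrightarrow>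
     0 \<le> C \<and> 0 \<le> D \<and>
     (\<forall>k. \<forall>l<Q. subalgebra M (F k l)) \<and>
     (\<forall>k l. Suc l < Q \<longrightarrow> subalgebra (F k (Suc l)) (F k l)) \<and>
     (\<forall>k. subalgebra (F (Suc k) 0) (F k (Q - 1))) \<and>
     (\<forall>k. \<forall>i\<in>{1..n}. \<forall>l<Q.
        local_iterate n Q g \<xi> \<alpha> x0 i k l \<in> borel_measurable (F k l) \<and>
        stoch_grad n Q g \<xi> \<alpha> x0 i k l \<in> borel_measurable (F (Suc k) l) \<and>
        (\<forall>x. (\<lambda>\<omega>. g i x (\<xi> i k l \<omega>)) \<in> borel_measurable M) \<and>
        (\<forall>x. abc_at M (F k l) C D (f i) (\<lambda>\<omega>. x) (\<lambda>\<omega>. g i x (\<xi> i k l \<omega>))) \<and>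
        abc_at M (F k l) C D (f i)
          (local_iterate n Q g \<xi> \<alpha> x0 i k l) (stoch_grad n Q g \<xi> \<alpha> x0 i k l)) \<and>
     (\<forall>k. \<forall>l<Q. cond_indep_vars M (F k l) borel
        (\<lambda>i. stoch_grad n Q g \<xi> \<alpha> x0 i k l) {1..n})"

end

theory Submission
  imports Defs
begin

text \<open>
  A round of FedAvg is a gradient step of length \<open>\<alpha> t * Q\<close> on the averaged objective
  \<open>favg\<close>, disturbed in two ways (\<open>round_decomposition\<close>): by a drift error, because the
  agents evaluate their gradients at their local iterates, and by noise that is centred given the
  past. As the local iterates move a distance of order \<open>\<alpha> t\<close>, the second moments of the total
  drift contribution and of the noise of a round are of order \<open>(\<alpha> t)\<^sup>4\<close> and
  \<open>(\<alpha> t)\<^sup>2\<close>, up to the factor \<open>mean_gap t + 1\<close>. Here \<open>mean_gap t\<close> is the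
  expected distance of \<open>favg (x t)\<close> from the average of the infima of the objectives. This factor
  appears because the ABC condition bounds the variance by the function values and these bound the
  squared gradients.

  The descent lemma then gives \<open>mean_gap_step\<close>, a recursion for \<open>mean_gap\<close> in which a
  multiple of \<open>\<alpha> t * E |gradient favg (x t)|\<^sup>2\<close> is gained and only terms of order
  \<open>(\<alpha> t)\<^sup>2\<close> are lost. Square summability of the step sizes therefore bounds
  \<open>mean_gap\<close> and makes \<open>\<Sum>t. \<alpha> t * E |gradient favg (x t)|\<^sup>2\<close> finite
  (\<open>perturbed_decrease\<close>).

  This already implies that almost surely \<open>\<Sum>t. \<alpha> t * |gradient favg (x t)|\<^sup>2\<close>
  converges, hence the gradient is small infinitely often, as the step sizes are not summable. To
  exclude that it also returns to large values infinitely often, the path has to be controlled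
  between such times: a return forces the iterates to travel a fixed distance while the gradient is
  bounded away from zero. On such a stretch the gradient part of the path is dominated by the
  convergent series above, the drift part by another one, and the noise part by the tails of a
  martingale with summable second moments, which converges almost surely by Kolmogorov's maximal
  inequality (\<open>AE_convergent_sum\<close>). So late returns do not happen
  (\<open>tendsto_zero_if_no_late_excursion\<close>).

  Convergence of the means follows from almost sure convergence, because the second moments of the
  gradients are bounded by \<open>mean_gap\<close>, so the gradient norms are uniformly integrable.
\<close>

section \<open>Smooth functions\<close>

lemma GDERIV_unique:
  fixes f :: "'a::real_inner \<Rightarrow> real"
  assumes "GDERIV f x :> E" "GDERIV f x :> D"
  shows "E = D"
proof -
  have "(\<lambda>h. h \<bullet> E) = (\<lambda>h. h \<bullet> D)"
    using assms has_derivative_unique unfolding gderiv_def by blast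
  then have "(E - D) \<bullet> E = (E - D) \<bullet> D" by metis
  then have "(E - D) \<bullet> (E - D) = 0" by (simp add: inner_diff_right)
  then show ?thesis by simp
qed

text \<open>The gradient is the Riesz representative of the derivative; finite dimension makes it
  available as an explicit sum over an orthonormal basis.\<close>

lemma gderiv_gradient:
  fixes f :: "'a::euclidean_space \<Rightarrow> real"
  assumes "f differentiable (at x)"
  shows "GDERIV f x :> gradient f x"
proof -
  obtain f' where f': "(f has_derivative f') (at x)"
    using assms unfolding differentiable_def by blast
  then interpret f': bounded_linear f' by (rule has_derivative_bounded_linear)
  define D where "D = (\<Sum>b\<in>Basis. f' b *\<^sub>R b)"
  have "f' h = h \<bullet> D" for h
  proof -
    have "f' h = f' (\<Sum>b\<in>Basis. (h \<bullet> b) *\<^sub>R b)"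
      by (simp add: euclidean_representation)
    also have "\<dots> = (\<Sum>b\<in>Basis. (h \<bullet> b) * f' b)"
      by (simp add: f'.sum f'.scaleR)
    also have "\<dots> = h \<bullet> D"
      unfolding D_def by (simp add: inner_sum_right mult.commute)
    finally show ?thesis .
  qed
  then have D: "GDERIV f x :> D"
    using f' unfolding gderiv_def by (metis (no_types, lifting) ext)
  then show ?thesis unfolding gradient_def by (rule theI) (rule GDERIV_unique[OF _ D])
qed

lemma gradient_eqI:
  fixes f :: "'a::euclidean_space \<Rightarrow> real"
  assumes "GDERIV f x :> D"
  shows "gradient f x = D"
proof -
  have "f differentiable (at x)"
    using assms unfolding gderiv_def differentiable_def by blast
  then show ?thesis using gderiv_gradient GDERIV_unique[OF _ assms] by blast
qed

lemma L_smoothD: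
  fixes f :: "'a::euclidean_space \<Rightarrow> real"
  assumes "L_smooth L f"
  shows "GDERIV f x :> gradient f x"
    and "norm (gradient f x - gradient f y) \<le> L * norm (x - y)"
  using assms gderiv_gradient unfolding L_smooth_def by blast+

lemma L_smooth_mono:
  assumes "L_smooth L f" "L \<le> L'"
  shows "L_smooth L' f"
  using assms unfolding L_smooth_def
  by (meson order_trans mult_right_mono norm_ge_zero)

lemma continuous_gradient:
  fixes f :: "'a::euclidean_space \<Rightarrow> real"
  assumes "L_smooth L f"
  shows "continuous_on UNIV (gradient f)"
proof -
  have "(max L 0)-lipschitz_on UNIV (gradient f)"
    using L_smoothD(2)[OF L_smooth_mono[OF assms, of "max L 0"]]
    by (intro lipschitz_onI) (auto simp: dist_norm)
  then show ?thesis by (rule lipschitz_on_continuous_on)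
qed

lemma continuous_L_smooth:
  fixes f :: "'a::euclidean_space \<Rightarrow> real"
  assumes "L_smooth L f"
  shows "continuous_on UNIV f"
  using assms unfolding L_smooth_def
  by (simp add: continuous_at_imp_continuous_on differentiable_imp_continuous_within)

text \<open>The descent lemma: along the segment from \<open>x\<close> to \<open>y\<close>, subtracting the claimed upper bound
  from \<open>f\<close> leaves a function whose derivative is nonpositive, by the Lipschitz bound on the
  gradient.\<close>

lemma L_smooth_upper_bound:
  fixes f :: "'a::euclidean_space \<Rightarrow> real"
  assumes "L_smooth L f"
  shows "f y \<le> f x + (y - x) \<bullet> gradient f x + L / 2 * (norm (y - x))\<^sup>2"
proof -
  define d where "d = y - x"
  define \<phi> where "\<phi> s = f (x + s *\<^sub>R d) - s * (d \<bullet> gradient f x) - L / 2 * s\<^sup>2 * (norm d)\<^sup>2" for s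
  have "(\<lambda>s. f (x + s *\<^sub>R d)) = f \<circ> (\<lambda>s. x + s *\<^sub>R d)" by auto
  moreover have "((f \<circ> (\<lambda>s. x + s *\<^sub>R d)) has_derivative
      (\<lambda>h. h \<bullet> gradient f (x + s *\<^sub>R d)) \<circ> (\<lambda>t. t *\<^sub>R d)) (at s)" for s
    using L_smoothD(1)[OF assms] unfolding gderiv_def
    by (intro diff_chain_at) (auto intro!: derivative_eq_intros)
  ultimately have line: "((\<lambda>s. f (x + s *\<^sub>R d)) has_real_derivative d \<bullet> gradient f (x + s *\<^sub>R d)) (at s)"
    for s
    by (simp add: has_field_derivative_def o_def mult_commute_abs)
  have deriv: "(\<phi> has_real_derivative
      d \<bullet> gradient f (x + s *\<^sub>R d) - d \<bullet> gradient f x - L * s * (norm d)\<^sup>2) (at s)" for s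
    unfolding \<phi>_def by (rule derivative_eq_intros line refl | simp)+
  have "\<phi> 1 \<le> \<phi> 0"
  proof (rule DERIV_nonpos_imp_nonincreasing[of 0 1 \<phi>])
    fix s :: real assume "0 \<le> s" "s \<le> 1"
    have "d \<bullet> gradient f (x + s *\<^sub>R d) - d \<bullet> gradient f x
        = d \<bullet> (gradient f (x + s *\<^sub>R d) - gradient f x)"
      by (simp add: inner_diff_right)
    also have "\<dots> \<le> norm d * norm (gradient f (x + s *\<^sub>R d) - gradient f x)"
      by (rule norm_cauchy_schwarz)
    also have "\<dots> \<le> norm d * (L * norm (s *\<^sub>R d))"
      using L_smoothD(2)[OF assms, of "x + s *\<^sub>R d" x] by (intro mult_left_mono) auto
    also have "\<dots> = L * s * (norm d)\<^sup>2"
      using \<open>0 \<le> s\<close> by (simp add: power2_eq_square)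
    finally show "\<exists>z. (\<phi> has_real_derivative z) (at s) \<and> z \<le> 0"
      using deriv[of s] by (intro exI conjI) auto
  qed simp
  then show ?thesis unfolding \<phi>_def d_def by simp
qed

text \<open>One exact gradient step of length \<open>1 / L\<close> decreases \<open>f\<close> by at least
  \<open>norm (gradient f x) ^ 2 / (2 * L)\<close>, and cannot take it below the lower bound \<open>c\<close>.\<close>

lemma norm_gradient_sq_le_gap:
  fixes f :: "'a::euclidean_space \<Rightarrow> real"
  assumes "L_smooth L f" "L > 0" and lower: "\<And>y. c \<le> f y"
  shows "(norm (gradient f x))\<^sup>2 \<le> 2 * L * (f x - c)"
proof -
  define g where "g = gradient f x"
  have "c \<le> f (x - (1 / L) *\<^sub>R g)" by (rule lower)
  also have "\<dots> \<le> f x + (- ((1 / L) *\<^sub>R g)) \<bullet> g + L / 2 * (norm (- ((1 / L) *\<^sub>R g)))\<^sup>2"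
    using L_smooth_upper_bound[OF assms(1), of "x - (1 / L) *\<^sub>R g" x] unfolding g_def by simp
  also have "\<dots> = f x - (norm g)\<^sup>2 / (2 * L)"
    using \<open>L > 0\<close> by (simp add: power2_norm_eq_inner[symmetric] power_mult_distrib power_divide
      field_simps power2_eq_square)
  finally show ?thesis
    using \<open>L > 0\<close> unfolding g_def by (simp add: field_simps)
qed

lemma avg_fun_gradient:
  fixes f :: "nat \<Rightarrow> 'a::euclidean_space \<Rightarrow> real"
  assumes "\<And>i. i \<in> {1..n} \<Longrightarrow> L_smooth L (f i)"
  shows "GDERIV (avg_fun n f) x :> (1 / real n) *\<^sub>R (\<Sum>i = 1..n. gradient (f i) x)"
    and "gradient (avg_fun n f) x = (1 / real n) *\<^sub>R (\<Sum>i = 1..n. gradient (f i) x)"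
proof -
  have *: "((\<lambda>y. (1 / real n) * (\<Sum>i = 1..n. f i y)) has_derivative
     (\<lambda>h. (1 / real n) * (\<Sum>i = 1..n. h \<bullet> gradient (f i) x))) (at x)"
    using L_smoothD(1)[OF assms] unfolding gderiv_def
    by (intro has_derivative_mult_right has_derivative_sum) auto
  have "avg_fun n f = (\<lambda>y. (1 / real n) * (\<Sum>i = 1..n. f i y))"
    by (auto simp: avg_fun_def)
  then show "GDERIV (avg_fun n f) x :> (1 / real n) *\<^sub>R (\<Sum>i = 1..n. gradient (f i) x)"
    using * unfolding gderiv_def by (simp add: inner_sum_right)
  then show "gradient (avg_fun n f) x = (1 / real n) *\<^sub>R (\<Sum>i = 1..n. gradient (f i) x)"
    by (rule gradient_eqI)
qed

lemma L_smooth_avg_fun: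
  fixes f :: "nat \<Rightarrow> 'a::euclidean_space \<Rightarrow> real"
  assumes "n \<ge> 1" "\<And>i. i \<in> {1..n} \<Longrightarrow> L_smooth L (f i)"
  shows "L_smooth L (avg_fun n f)"
  unfolding L_smooth_def
proof (intro conjI allI)
  show "avg_fun n f differentiable at x" for x
    using avg_fun_gradient(1)[of n L f x] assms(2) unfolding gderiv_def differentiable_def by blast
  fix x y
  have grad: "gradient (avg_fun n f) z = (1 / real n) *\<^sub>R (\<Sum>i = 1..n. gradient (f i) z)" for z
    by (rule avg_fun_gradient(2)) (rule assms(2))
  have "norm (gradient (avg_fun n f) x - gradient (avg_fun n f) y)
      = (1 / real n) * norm (\<Sum>i = 1..n. gradient (f i) x - gradient (f i) y)"
    unfolding grad scaleR_diff_right[symmetric] sum_subtractf[symmetric] by simp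
  also have "\<dots> \<le> (1 / real n) * (\<Sum>i = 1..n. L * norm (x - y))"
    by (intro mult_left_mono order_trans[OF norm_sum] sum_mono L_smoothD(2) assms(2)) auto
  also have "\<dots> = L * norm (x - y)" using \<open>n \<ge> 1\<close> by simp
  finally show "norm (gradient (avg_fun n f) x - gradient (avg_fun n f) y) \<le> L * norm (x - y)" .
qed

section \<open>Two deterministic lemmas\<close>

text \<open>The recursion is a perturbed decrease. The factors \<open>1 + c t\<close> have a bounded product because
  \<open>1 + c t \<le> exp (c t)\<close>, which bounds \<open>W\<close>; then summing the recursion bounds the partial sums of
  \<open>b\<close>.\<close>

lemma perturbed_decrease:
  fixes W b c :: "nat \<Rightarrow> real"
  assumes W: "\<And>t. 0 \<le> W t" and b: "\<And>t. 0 \<le> b t" and c: "\<And>t. 0 \<le> c t" "summable c"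
    and step: "\<And>t. W (Suc t) \<le> (1 + c t) * W t - b t"
  obtains B where "\<And>t. W t \<le> B" "summable b"
proof -
  define B where "B = exp (suminf c) * W 0"
  have part: "(\<Sum>s<t. c s) \<le> suminf c" for t
    using c by (intro sum_le_suminf) auto
  have "W t \<le> exp (\<Sum>s<t. c s) * W 0" for t
  proof (induction t)
    case (Suc t)
    have "W (Suc t) \<le> (1 + c t) * W t" using step[of t] b[of t] by linarith
    also have "\<dots> \<le> exp (c t) * W t"
      using W[of t] by (intro mult_right_mono) auto
    also have "\<dots> \<le> exp (c t) * (exp (\<Sum>s<t. c s) * W 0)"
      using Suc by simp
    finally show ?case by (simp add: exp_add mult_ac)
  qed simp
  moreover have "exp (\<Sum>s<t. c s) * W 0 \<le> B" for t
    unfolding B_def using part W by (intro mult_right_mono) auto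
  ultimately have B: "W t \<le> B" for t by (meson order_trans)
  have sum_b: "(\<Sum>s<t. b s) \<le> W 0 - W t + B * (\<Sum>s<t. c s)" for t
  proof (induction t)
    case (Suc t)
    have "b t \<le> W t - W (Suc t) + c t * W t" using step[of t] by (simp add: algebra_simps)
    also have "c t * W t \<le> c t * B" using B c by (intro mult_left_mono) auto
    finally show ?case using Suc by (simp add: algebra_simps)
  qed simp
  have "0 \<le> B" using B W order_trans by blast
  have "(\<Sum>s<t. b s) \<le> W 0 + B * suminf c" for t
    using sum_b[of t] W[of t] mult_left_mono[OF part[of t] \<open>0 \<le> B\<close>] by linarith
  then have "summable b"
    using b by (intro bounded_imp_summable[where B = "W 0 + B * suminf c"])
      (auto simp only: lessThan_Suc_atMost[symmetric])
  with B that show ?thesis by blast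
qed

lemma late_blocks_small:
  fixes m :: "nat \<Rightarrow> 'a::real_normed_vector"
  assumes "convergent (\<lambda>T. \<Sum>t<T. m t)" "\<eta> > 0"
  obtains N where "\<And>s e. N \<le> s \<Longrightarrow> s \<le> e \<Longrightarrow> norm (\<Sum>t=s..<e. m t) < \<eta>"
proof -
  have "Cauchy (\<lambda>T. \<Sum>t<T. m t)" using assms(1) by (rule convergent_Cauchy)
  then obtain N where N: "\<And>s e. N \<le> s \<Longrightarrow> N \<le> e \<Longrightarrow> norm ((\<Sum>t<e. m t) - (\<Sum>t<s. m t)) < \<eta>"
    using assms(2) unfolding Cauchy_iff by meson
  have "norm (\<Sum>t=s..<e. m t) < \<eta>" if "N \<le> s" "s \<le> e" for s e
  proof -
    have "(\<Sum>t<e. m t) = (\<Sum>t<s. m t) + (\<Sum>t=s..<e. m t)"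
      using that(2) by (metis atLeast0LessThan le0 sum.atLeastLessThan_concat)
    with N[of s e] that show ?thesis by simp
  qed
  then show thesis by (rule that)
qed

text \<open>Since the weights \<open>\<alpha>\<close> are not summable, \<open>G\<close> falls below \<open>\<epsilon> / 2\<close> infinitely often. To come
  back above \<open>\<epsilon>\<close> afterwards, \<open>y\<close> has to travel a distance of at least \<open>\<epsilon> / (2 * L)\<close> while
  \<open>G \<ge> \<epsilon> / 2\<close>. During such an excursion \<open>\<alpha> t * G t \<le> (2 / \<epsilon>) * \<alpha> t * (G t)\<^sup>2\<close>, so the path length
  is bounded by tails of convergent series, except for the first step, which still starts below
  \<open>\<epsilon> / 2\<close> and is short because \<open>\<alpha>\<close> tends to zero. Hence late excursions cannot occur.\<close>

lemma tendsto_zero_if_no_late_excursion: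
  fixes y m v :: "nat \<Rightarrow> 'a::real_normed_vector" and G \<alpha> \<rho> :: "nat \<Rightarrow> real"
  assumes G: "\<And>t. 0 \<le> G t" and \<alpha>: "\<And>t. 0 \<le> \<alpha> t" "\<alpha> \<longlonglongrightarrow> 0" "\<not> summable \<alpha>"
    and "0 < L" and lip: "\<And>s t. \<bar>G s - G t\<bar> \<le> L * norm (y s - y t)"
    and step: "\<And>t. y (Suc t) = y t + v t + m t"
    and m: "convergent (\<lambda>T. \<Sum>t<T. m t)"
    and "0 < c" and v: "\<And>t. norm (v t) \<le> c * (\<alpha> t * G t) + \<rho> t"
    and \<rho>: "summable \<rho>" and sumG: "summable (\<lambda>t. \<alpha> t * (G t)\<^sup>2)"
  shows "G \<longlonglongrightarrow> 0"
proof (rule LIMSEQ_I)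
  fix \<epsilon> :: real assume "\<epsilon> > 0"
  \<comment> \<open>\<open>\<eta> * K\<close> will bound the path length: one \<open>\<eta>\<close> each for noise and error, \<open>c * \<epsilon> / 2\<close> for the
    first step and \<open>2 * c / \<epsilon>\<close> for the rest of the excursion.\<close>
  define K where "K = 2 + c * \<epsilon> / 2 + 2 * c / \<epsilon>"
  have "K > 0" unfolding K_def using \<open>\<epsilon> > 0\<close> \<open>0 < c\<close> by (simp add: add_pos_pos)
  define \<eta> where "\<eta> = \<epsilon> / (4 * L * K)"
  have "\<eta> > 0" unfolding \<eta>_def using \<open>\<epsilon> > 0\<close> \<open>0 < L\<close> \<open>K > 0\<close> by simp
  have \<eta>: "L * (\<eta> * K) < \<epsilon> / 2"
    unfolding \<eta>_def using \<open>\<epsilon> > 0\<close> \<open>0 < L\<close> \<open>K > 0\<close> by (simp add: field_simps)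
  obtain N1 where N1: "\<And>s e. N1 \<le> s \<Longrightarrow> s \<le> e \<Longrightarrow> norm (\<Sum>t=s..<e. m t) < \<eta>"
    using late_blocks_small[OF m \<open>\<eta> > 0\<close>] by blast
  obtain N2 where N2: "\<And>s e. N2 \<le> s \<Longrightarrow> s \<le> e \<Longrightarrow> norm (\<Sum>t=s..<e. \<rho> t) < \<eta>"
    using late_blocks_small[OF _ \<open>\<eta> > 0\<close>] \<rho> unfolding summable_iff_convergent by blast
  obtain N3 where N3: "\<And>s e. N3 \<le> s \<Longrightarrow> s \<le> e \<Longrightarrow> norm (\<Sum>t=s..<e. \<alpha> t * (G t)\<^sup>2) < \<eta>"
    using late_blocks_small[OF _ \<open>\<eta> > 0\<close>] sumG unfolding summable_iff_convergent by blast
  obtain N4 where N4: "\<And>t. N4 \<le> t \<Longrightarrow> \<alpha> t < \<eta>"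
    using order_tendstoD(2)[OF \<alpha>(2) \<open>\<eta> > 0\<close>] unfolding eventually_sequentially by blast
  define N where "N = max (max N1 N2) (max N3 N4)"
  have "\<exists>s\<ge>N. G s < \<epsilon> / 2"
  proof (rule ccontr)
    assume "\<not> ?thesis"
    then have large: "\<epsilon> / 2 \<le> G t" if "t \<ge> N" for t using that by force
    have "norm (\<alpha> t) \<le> (4 / \<epsilon>\<^sup>2) * (\<alpha> t * (G t)\<^sup>2)" if "t \<ge> N" for t
    proof -
      have "(\<epsilon> / 2)\<^sup>2 \<le> (G t)\<^sup>2" using large[OF that] \<open>\<epsilon> > 0\<close> by (intro power_mono) auto
      then have "\<alpha> t * (\<epsilon> / 2)\<^sup>2 \<le> \<alpha> t * (G t)\<^sup>2" using \<alpha>(1) by (intro mult_left_mono) auto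
      then show ?thesis using \<open>\<epsilon> > 0\<close> \<alpha>(1)[of t] by (simp add: field_simps)
    qed
    then have "summable \<alpha>"
      by (intro summable_comparison_test[OF _ summable_mult[OF sumG, of "4 / \<epsilon>\<^sup>2"]]) blast
    with \<alpha>(3) show False ..
  qed
  then obtain s0 where s0: "s0 \<ge> N" "G s0 < \<epsilon> / 2" by blast
  have "G t < \<epsilon>" if "t \<ge> s0" for t
  proof (rule ccontr)
    assume "\<not> G t < \<epsilon>"
    then have Gt: "G t \<ge> \<epsilon>" by simp
    define s where "s = (GREATEST s. s \<le> t \<and> G s < \<epsilon> / 2)"
    have s: "s \<le> t \<and> G s < \<epsilon> / 2" unfolding s_def
      by (rule GreatestI_nat[of "\<lambda>s. s \<le> t \<and> G s < \<epsilon> / 2" s0 t]) (use s0 that in auto)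
    have greatest: "j \<le> s" if "j \<le> t" "G j < \<epsilon> / 2" for j unfolding s_def
      by (rule Greatest_le_nat[of "\<lambda>s. s \<le> t \<and> G s < \<epsilon> / 2" _ t]) (use that in auto)
    have "s0 \<le> s" using greatest that s0 by blast
    then have "N \<le> s" using s0 by simp
    have "s < t" using s Gt \<open>\<epsilon> > 0\<close> by (cases "s = t") auto
    have "y (s + d) = y s + (\<Sum>j=s..<s+d. v j) + (\<Sum>j=s..<s+d. m j)" for d
      by (induction d) (simp_all add: step)
    from this[of "t - s"] have "y t - y s = (\<Sum>j=s..<t. v j) + (\<Sum>j=s..<t. m j)"
      using \<open>s < t\<close> by simp
    then have "norm (y t - y s) \<le> norm (\<Sum>j=s..<t. v j) + norm (\<Sum>j=s..<t. m j)"
      by (metis norm_triangle_ineq)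
    also have "norm (\<Sum>j=s..<t. v j) \<le> (\<Sum>j=s..<t. c * (\<alpha> j * G j) + \<rho> j)"
      by (intro order_trans[OF norm_sum] sum_mono v)
    also have "\<dots> = c * (\<alpha> s * G s) + c * (\<Sum>j=Suc s..<t. \<alpha> j * G j) + (\<Sum>j=s..<t. \<rho> j)"
      using \<open>s < t\<close> by (simp add: sum.distrib sum_distrib_left sum.atLeast_Suc_lessThan)
    finally have path: "norm (y t - y s) \<le> c * (\<alpha> s * G s) + c * (\<Sum>j=Suc s..<t. \<alpha> j * G j)
        + (\<Sum>j=s..<t. \<rho> j) + norm (\<Sum>j=s..<t. m j)" by simp
    have noise: "norm (\<Sum>j=s..<t. m j) \<le> \<eta>"
      using N1[of s t] \<open>N \<le> s\<close> \<open>s < t\<close> unfolding N_def by simp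
    have error: "(\<Sum>j=s..<t. \<rho> j) \<le> \<eta>"
      using N2[of s t] \<open>N \<le> s\<close> \<open>s < t\<close> unfolding N_def by simp
    have first: "c * (\<alpha> s * G s) \<le> c * (\<eta> * (\<epsilon> / 2))"
      using N4[of s] \<open>N \<le> s\<close> s G[of s] \<alpha>(1)[of s] \<open>0 < c\<close> unfolding N_def
      by (intro mult_left_mono mult_mono) auto
    have "(\<Sum>j=Suc s..<t. \<alpha> j * G j) \<le> (\<Sum>j=Suc s..<t. (2 / \<epsilon>) * (\<alpha> j * (G j)\<^sup>2))"
    proof (rule sum_mono)
      fix j assume "j \<in> {Suc s..<t}"
      then have "G j \<ge> \<epsilon> / 2" using greatest[of j] by force
      then have "\<alpha> j * G j * (\<epsilon> / 2) \<le> \<alpha> j * G j * G j"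
        using \<alpha>(1) G by (intro mult_left_mono) auto
      then show "\<alpha> j * G j \<le> (2 / \<epsilon>) * (\<alpha> j * (G j)\<^sup>2)"
        using \<open>\<epsilon> > 0\<close> by (simp add: field_simps power2_eq_square)
    qed
    also have "\<dots> = (2 / \<epsilon>) * (\<Sum>j=Suc s..<t. \<alpha> j * (G j)\<^sup>2)"
      by (simp add: sum_distrib_left)
    also have "\<dots> \<le> (2 / \<epsilon>) * \<eta>"
      using N3[of "Suc s" t] \<open>N \<le> s\<close> \<open>s < t\<close> \<open>\<epsilon> > 0\<close> unfolding N_def
      by (intro mult_left_mono) auto
    finally have "c * (\<Sum>j=Suc s..<t. \<alpha> j * G j) \<le> c * ((2 / \<epsilon>) * \<eta>)"
      by (rule mult_left_mono) (use \<open>0 < c\<close> in simp)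
    with path noise error first
    have "norm (y t - y s) \<le> c * (\<eta> * (\<epsilon> / 2)) + c * ((2 / \<epsilon>) * \<eta>) + \<eta> + \<eta>"
      by linarith
    also have "\<dots> = \<eta> * K" unfolding K_def by (simp add: algebra_simps)
    finally have "L * norm (y t - y s) < \<epsilon> / 2"
      using \<eta> mult_left_mono[of "norm (y t - y s)" "\<eta> * K" L] \<open>0 < L\<close> by linarith
    with lip[of t s] s Gt show False by linarith
  qed
  then have "\<forall>t\<ge>s0. norm (G t - 0) < \<epsilon>" using G by simp
  then show "\<exists>n0. \<forall>t\<ge>n0. norm (G t - 0) < \<epsilon>" by blast
qed

section \<open>Square-integrable random vectors\<close>

definition square_integrable :: "'w measure \<Rightarrow> ('w \<Rightarrow> 'a::euclidean_space) \<Rightarrow> bool" where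
  "square_integrable M X \<longleftrightarrow>
     X \<in> borel_measurable M \<and> integrable M (\<lambda>\<omega>. (norm (X \<omega>))\<^sup>2)"

lemma square_integrable_measurable:
  "square_integrable M X \<Longrightarrow> X \<in> borel_measurable M"
  by (simp add: square_integrable_def)

lemma square_integrableD:
  "square_integrable M X \<Longrightarrow> integrable M (\<lambda>\<omega>. (norm (X \<omega>))\<^sup>2)"
  by (simp add: square_integrable_def)

lemma norm_add_sq_le: "(norm (x + y))\<^sup>2 \<le> 2 * (norm x)\<^sup>2 + 2 * (norm y)\<^sup>2"
  for x y :: "'a::real_normed_vector"
proof -
  have "(norm (x + y))\<^sup>2 \<le> (norm x + norm y)\<^sup>2"
    by (intro power_mono norm_triangle_ineq) auto
  also have "\<dots> \<le> 2 * (norm x)\<^sup>2 + 2 * (norm y)\<^sup>2"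
    using sum_squares_bound[of "norm x" "norm y"] by (simp add: power2_sum)
  finally show ?thesis .
qed

lemma norm_sum_sq_le:
  fixes v :: "'i \<Rightarrow> 'a::real_normed_vector"
  shows "(norm (\<Sum>i\<in>I. v i))\<^sup>2 \<le> real (card I) * (\<Sum>i\<in>I. (norm (v i))\<^sup>2)"
proof -
  have "(norm (\<Sum>i\<in>I. v i))\<^sup>2 \<le> (\<Sum>i\<in>I. norm (v i))\<^sup>2"
    by (intro power_mono norm_sum) auto
  also have "\<dots> \<le> (\<Sum>i\<in>I. (norm (v i))\<^sup>2) * real (card I)"
    by (rule sum_squared_le_sum_of_squares)
  finally show ?thesis by (simp add: mult.commute)
qed

lemma inner_le_half_squares: "x \<bullet> y \<le> (norm x)\<^sup>2 / 2 + (norm y)\<^sup>2 / 2"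
  for x y :: "'a::real_inner"
  using norm_cauchy_schwarz[of x y] sum_squares_bound[of "norm x" "norm y"] by simp

lemma square_integrable_dominated:
  assumes "X \<in> borel_measurable M" "integrable M h" "\<And>\<omega>. \<omega> \<in> space M \<Longrightarrow> (norm (X \<omega>))\<^sup>2 \<le> h \<omega>"
  shows "square_integrable M X"
  unfolding square_integrable_def
  using assms(1) by (auto intro!: Bochner_Integration.integrable_bound[OF assms(2)] AE_I2
      order_trans[OF assms(3)])

lemma square_integrable_add:
  assumes "square_integrable M X" "square_integrable M Y"
  shows "square_integrable M (\<lambda>\<omega>. X \<omega> + Y \<omega>)"
  by (rule square_integrable_dominated[where h = "\<lambda>\<omega>. 2 * (norm (X \<omega>))\<^sup>2 + 2 * (norm (Y \<omega>))\<^sup>2"])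
    (use assms in \<open>auto intro!: norm_add_sq_le square_integrableD borel_measurable_add
      dest: square_integrable_measurable\<close>)

lemma square_integrable_scaleR:
  assumes "square_integrable M X"
  shows "square_integrable M (\<lambda>\<omega>. c *\<^sub>R X \<omega>)"
  using assms unfolding square_integrable_def by (auto simp: power_mult_distrib)

lemma square_integrable_diff:
  assumes "square_integrable M X" "square_integrable M Y"
  shows "square_integrable M (\<lambda>\<omega>. X \<omega> - Y \<omega>)"
  using square_integrable_add[OF assms(1) square_integrable_scaleR[OF assms(2), of "-1"]] by simp

lemma (in finite_measure) square_integrable_const: "square_integrable M (\<lambda>\<omega>. c)"
  by (simp add: square_integrable_def)

lemma (in finite_measure) square_integrable_sum:
  assumes "\<And>i. i \<in> I \<Longrightarrow> square_integrable M (X i)"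
  shows "square_integrable M (\<lambda>\<omega>. \<Sum>i\<in>I. X i \<omega>)"
  using assms
  by (induction I rule: infinite_finite_induct)
    (auto intro!: square_integrable_add square_integrable_const)

lemma integrable_inner:
  assumes "square_integrable M X" "square_integrable M Y"
  shows "integrable M (\<lambda>\<omega>. X \<omega> \<bullet> Y \<omega>)"
proof (rule Bochner_Integration.integrable_bound)
  show "integrable M (\<lambda>\<omega>. (norm (X \<omega>))\<^sup>2 + (norm (Y \<omega>))\<^sup>2)"
    using assms by (intro Bochner_Integration.integrable_add square_integrableD)
  show "(\<lambda>\<omega>. X \<omega> \<bullet> Y \<omega>) \<in> borel_measurable M"
    using assms by (intro borel_measurable_inner square_integrable_measurable)
  have "\<bar>x \<bullet> y\<bar> \<le> (norm x)\<^sup>2 + (norm y)\<^sup>2" for x y :: 'b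
    using inner_le_half_squares[of x y] inner_le_half_squares[of "-x" y]
      zero_le_power2[of "norm x"] zero_le_power2[of "norm y"]
    unfolding inner_minus_left norm_minus_cancel by linarith
  then show "AE \<omega> in M. norm (X \<omega> \<bullet> Y \<omega>) \<le> norm ((norm (X \<omega>))\<^sup>2 + (norm (Y \<omega>))\<^sup>2)"
    by auto
qed

lemma (in finite_measure) integrable_norm_of_square_integrable:
  assumes "square_integrable M X"
  shows "integrable M (\<lambda>\<omega>. norm (X \<omega>))"
proof (rule Bochner_Integration.integrable_bound)
  show "integrable M (\<lambda>\<omega>. 1 + (norm (X \<omega>))\<^sup>2)"
    using assms by (intro Bochner_Integration.integrable_add square_integrableD) auto
  have "\<bar>r\<bar> \<le> \<bar>1 + r\<^sup>2\<bar>" for r :: real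
    using sum_squares_bound[of "\<bar>r\<bar>" 1] by simp
  from this[of "norm (X \<omega>)" for \<omega>]
  show "AE \<omega> in M. norm (norm (X \<omega>)) \<le> norm (1 + (norm (X \<omega>))\<^sup>2)"
    unfolding real_norm_def by (intro AE_I2)
qed (use square_integrable_measurable[OF assms] in simp)

lemma (in prob_space) second_moment_add:
  assumes X: "square_integrable M X" and Y: "square_integrable M Y"
    and orth: "(\<integral>\<omega>. X \<omega> \<bullet> Y \<omega> \<partial>M) = 0"
  shows "(\<integral>\<omega>. (norm (X \<omega> + Y \<omega>))\<^sup>2 \<partial>M) = (\<integral>\<omega>. (norm (X \<omega>))\<^sup>2 \<partial>M) + (\<integral>\<omega>. (norm (Y \<omega>))\<^sup>2 \<partial>M)"
proof -
  have "(norm (x + y))\<^sup>2 = (norm x)\<^sup>2 + (norm y)\<^sup>2 + 2 * (x \<bullet> y)" for x y :: 'b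
    by (simp add: power2_norm_eq_inner inner_add inner_commute)
  then show ?thesis
    using integrable_inner[OF X Y] square_integrableD[OF X] square_integrableD[OF Y] orth
    by simp
qed

lemma (in prob_space) second_moment_sum_le:
  assumes "\<And>i. i \<in> I \<Longrightarrow> square_integrable M (X i)"
    and "\<And>i. i \<in> I \<Longrightarrow> (\<integral>\<omega>. (norm (X i \<omega>))\<^sup>2 \<partial>M) \<le> B"
  shows "(\<integral>\<omega>. (norm (\<Sum>i\<in>I. X i \<omega>))\<^sup>2 \<partial>M) \<le> (real (card I))\<^sup>2 * B"
proof -
  have int: "integrable M (\<lambda>\<omega>. \<Sum>i\<in>I. (norm (X i \<omega>))\<^sup>2)"
    using assms(1) by (intro Bochner_Integration.integrable_sum square_integrableD)
  have "(\<integral>\<omega>. (norm (\<Sum>i\<in>I. X i \<omega>))\<^sup>2 \<partial>M) \<le> (\<integral>\<omega>. real (card I) * (\<Sum>i\<in>I. (norm (X i \<omega>))\<^sup>2) \<partial>M)"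
    using int assms(1)
    by (intro integral_mono square_integrableD square_integrable_sum integrable_mult_right
        norm_sum_sq_le)
  also have "\<dots> = real (card I) * (\<Sum>i\<in>I. (\<integral>\<omega>. (norm (X i \<omega>))\<^sup>2 \<partial>M))"
    using assms(1) by (simp add: Bochner_Integration.integral_sum square_integrableD)
  also have "\<dots> \<le> real (card I) * (\<Sum>i\<in>I. B)"
    using assms(2) by (intro mult_left_mono sum_mono) auto
  finally show ?thesis by (simp add: power2_eq_square mult_ac)
qed

lemma (in prob_space) second_moment_average_le:
  assumes "n \<ge> 1" "\<And>i. i \<in> {1..n} \<Longrightarrow> square_integrable M (X i)"
    and "\<And>i. i \<in> {1..n} \<Longrightarrow> (\<integral>\<omega>. (norm (X i \<omega>))\<^sup>2 \<partial>M) \<le> B"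
  shows "(\<integral>\<omega>. (norm ((1 / real n) *\<^sub>R (\<Sum>i=1..n. X i \<omega>)))\<^sup>2 \<partial>M) \<le> B"
proof -
  have "(\<integral>\<omega>. (norm ((1 / real n) *\<^sub>R (\<Sum>i=1..n. X i \<omega>)))\<^sup>2 \<partial>M)
      = (1 / real n)\<^sup>2 * (\<integral>\<omega>. (norm (\<Sum>i=1..n. X i \<omega>))\<^sup>2 \<partial>M)"
    by (simp add: power_mult_distrib power_divide)
  also have "\<dots> \<le> (1 / real n)\<^sup>2 * ((real n)\<^sup>2 * B)"
    using second_moment_sum_le[of "{1..n}" X B] assms by (intro mult_left_mono) auto
  also have "\<dots> = B" using \<open>n \<ge> 1\<close> by (simp add: power_divide)
  finally show ?thesis .
qed

lemma (in prob_space) square_integrable_lipschitz_image: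
  fixes \<phi> :: "'b::euclidean_space \<Rightarrow> 'c::euclidean_space"
  assumes lip: "\<And>x y. norm (\<phi> x - \<phi> y) \<le> L * norm (x - y)" and "0 \<le> L"
    and X: "square_integrable M X"
  shows "square_integrable M (\<lambda>\<omega>. \<phi> (X \<omega>))"
proof (rule square_integrable_dominated)
  have "L-lipschitz_on UNIV \<phi>"
    using lip \<open>0 \<le> L\<close> by (intro lipschitz_onI) (auto simp: dist_norm)
  then have "\<phi> \<in> borel_measurable borel"
    by (intro borel_measurable_continuous_onI lipschitz_on_continuous_on)
  then show "(\<lambda>\<omega>. \<phi> (X \<omega>)) \<in> borel_measurable M"
    using X by (auto dest: square_integrable_measurable)
  show "integrable M (\<lambda>\<omega>. 2 * (L\<^sup>2 * (norm (X \<omega>))\<^sup>2) + 2 * (norm (\<phi> 0))\<^sup>2)"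
    using square_integrableD[OF X] by simp
  fix \<omega>
  have "(norm (\<phi> (X \<omega>)))\<^sup>2 \<le> 2 * (norm (\<phi> (X \<omega>) - \<phi> 0))\<^sup>2 + 2 * (norm (\<phi> 0))\<^sup>2"
    using norm_add_sq_le[of "\<phi> (X \<omega>) - \<phi> 0" "\<phi> 0"] by simp
  also have "(norm (\<phi> (X \<omega>) - \<phi> 0))\<^sup>2 \<le> (L * norm (X \<omega>))\<^sup>2"
    using lip[of "X \<omega>" 0] by (intro power_mono) auto
  finally show "(norm (\<phi> (X \<omega>)))\<^sup>2 \<le> 2 * (L\<^sup>2 * (norm (X \<omega>))\<^sup>2) + 2 * (norm (\<phi> 0))\<^sup>2"
    by (simp add: power_mult_distrib)
qed

text \<open>The upper bound of \<open>L_smooth_upper_bound\<close> is quadratic, so a smooth function that is bounded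
  below grows at most quadratically on both sides.\<close>

lemma (in prob_space) integrable_L_smooth:
  fixes \<phi> :: "'b::euclidean_space \<Rightarrow> real"
  assumes smooth: "L_smooth L \<phi>" and lower: "\<And>y. c \<le> \<phi> y" and X: "square_integrable M X"
  shows "integrable M (\<lambda>\<omega>. \<phi> (X \<omega>))"
proof (rule Bochner_Integration.integrable_bound)
  define h where "h x = \<bar>c\<bar> + \<bar>\<phi> 0\<bar> + (norm (gradient \<phi> 0))\<^sup>2 / 2 + (1 + \<bar>L\<bar>) / 2 * (norm x)\<^sup>2" for x :: 'b
  show "integrable M (\<lambda>\<omega>. h (X \<omega>))"
    unfolding h_def using square_integrableD[OF X] by simp
  have "\<phi> \<in> borel_measurable borel"
    using continuous_L_smooth[OF smooth] by (rule borel_measurable_continuous_onI)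
  then show "(\<lambda>\<omega>. \<phi> (X \<omega>)) \<in> borel_measurable M"
    using X by (auto dest: square_integrable_measurable)
  have "\<bar>\<phi> x\<bar> \<le> \<bar>h x\<bar>" for x
  proof -
    have "\<phi> x \<le> \<phi> 0 + x \<bullet> gradient \<phi> 0 + L / 2 * (norm x)\<^sup>2"
      using L_smooth_upper_bound[OF smooth, of x 0] by simp
    also have "x \<bullet> gradient \<phi> 0 \<le> (norm x)\<^sup>2 / 2 + (norm (gradient \<phi> 0))\<^sup>2 / 2"
      by (rule inner_le_half_squares)
    also have "L / 2 * (norm x)\<^sup>2 \<le> \<bar>L\<bar> / 2 * (norm x)\<^sup>2" by (intro mult_right_mono) auto
    finally have "\<phi> x \<le> \<phi> 0 + (norm (gradient \<phi> 0))\<^sup>2 / 2 + (1 + \<bar>L\<bar>) / 2 * (norm x)\<^sup>2"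
      by (simp add: field_simps)
    moreover have "0 \<le> (norm (gradient \<phi> 0))\<^sup>2 / 2" "0 \<le> (1 + \<bar>L\<bar>) / 2 * (norm x)\<^sup>2" by simp_all
    ultimately show ?thesis using lower[of x] unfolding h_def by linarith
  qed
  then show "AE \<omega> in M. norm (\<phi> (X \<omega>)) \<le> norm (h (X \<omega>))" by simp
qed

text \<open>A vector known at the conditioning time is orthogonal in mean to a vector whose conditional
  expectation vanishes. In each coordinate the known factor moves inside the conditional
  expectation.\<close>

lemma (in prob_space) expectation_inner_cond_centred:
  fixes G H Z :: "'a \<Rightarrow> real ^ 'p"
  assumes sub: "subalgebra M F"
    and G: "square_integrable M G" and H: "square_integrable M H"
    and Z: "square_integrable M Z" "Z \<in> borel_measurable F"
    and ce: "AE \<omega> in M. vec_cond_exp M F G \<omega> = H \<omega>"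
  shows "(\<integral>\<omega>. Z \<omega> \<bullet> (G \<omega> - H \<omega>) \<partial>M) = 0"
proof -
  interpret finite_measure_subalgebra M F using sub by unfold_locales
  have comp: "(\<lambda>\<omega>. X \<omega> $ j) \<in> borel_measurable N" if "X \<in> borel_measurable N"
    for X :: "'a \<Rightarrow> real ^ 'p" and j N
  proof -
    have "(\<lambda>\<omega>. X \<omega> \<bullet> axis j 1) \<in> borel_measurable N"
      using that by (intro borel_measurable_inner) auto
    then show ?thesis by (simp add: inner_axis)
  qed
  have coord: "integrable M (\<lambda>\<omega>. Z \<omega> $ j * X \<omega> $ j)" if "square_integrable M X" for X :: "'a \<Rightarrow> real ^ 'p" and j
  proof (rule Bochner_Integration.integrable_bound)
    show "integrable M (\<lambda>\<omega>. (norm (Z \<omega>))\<^sup>2 + (norm (X \<omega>))\<^sup>2)"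
      using that Z(1) by (intro Bochner_Integration.integrable_add square_integrableD)
    show "(\<lambda>\<omega>. Z \<omega> $ j * X \<omega> $ j) \<in> borel_measurable M"
      using that Z(1) by (intro borel_measurable_times comp square_integrable_measurable)
    have "\<bar>z $ j * x $ j\<bar> \<le> (norm z)\<^sup>2 + (norm x)\<^sup>2" for z x :: "real ^ 'p"
    proof -
      have "\<bar>z $ j * x $ j\<bar> \<le> norm z * norm x"
        unfolding abs_mult by (intro mult_mono component_le_norm_cart) auto
      with sum_squares_bound[of "norm z" "norm x"] show ?thesis
        using mult_nonneg_nonneg[OF norm_ge_zero[of z] norm_ge_zero[of x]] by linarith
    qed
    then show "AE \<omega> in M. norm (Z \<omega> $ j * X \<omega> $ j) \<le> norm ((norm (Z \<omega>))\<^sup>2 + (norm (X \<omega>))\<^sup>2)"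
      by simp
  qed
  have eq: "(\<integral>\<omega>. Z \<omega> $ j * G \<omega> $ j \<partial>M) = (\<integral>\<omega>. Z \<omega> $ j * H \<omega> $ j \<partial>M)" for j
  proof -
    have ce_j: "AE \<omega> in M. real_cond_exp M F (\<lambda>\<omega>. G \<omega> $ j) \<omega> = H \<omega> $ j"
      using ce by eventually_elim (simp add: vec_cond_exp_def vec_eq_iff)
    have "(\<integral>\<omega>. Z \<omega> $ j * G \<omega> $ j \<partial>M)
        = (\<integral>\<omega>. Z \<omega> $ j * real_cond_exp M F (\<lambda>\<omega>. G \<omega> $ j) \<omega> \<partial>M)"
      by (intro real_cond_exp_intg(2)[symmetric] coord[OF G] comp[OF Z(2)]
          comp[OF square_integrable_measurable[OF G]])
    also have "\<dots> = (\<integral>\<omega>. Z \<omega> $ j * H \<omega> $ j \<partial>M)"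
    proof (rule integral_cong_AE)
      show "(\<lambda>\<omega>. Z \<omega> $ j * H \<omega> $ j) \<in> borel_measurable M"
        using coord[OF H] by (rule borel_measurable_integrable)
      show "(\<lambda>\<omega>. Z \<omega> $ j * real_cond_exp M F (\<lambda>\<omega>. G \<omega> $ j) \<omega>) \<in> borel_measurable M"
        using comp[OF square_integrable_measurable[OF Z(1)]] by (intro borel_measurable_times) auto
    qed (use ce_j in auto)
    finally show ?thesis .
  qed
  have "(\<integral>\<omega>. Z \<omega> \<bullet> (G \<omega> - H \<omega>) \<partial>M)
      = (\<integral>\<omega>. (\<Sum>j\<in>UNIV. Z \<omega> $ j * G \<omega> $ j - Z \<omega> $ j * H \<omega> $ j) \<partial>M)"
    by (simp add: inner_vec_def algebra_simps)
  also have "\<dots> = (\<Sum>j\<in>UNIV. (\<integral>\<omega>. Z \<omega> $ j * G \<omega> $ j \<partial>M) - (\<integral>\<omega>. Z \<omega> $ j * H \<omega> $ j \<partial>M))"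
    using coord[OF G] coord[OF H] by (simp add: Bochner_Integration.integral_sum)
  finally show ?thesis by (simp add: eq)
qed

text \<open>The tower property turns a bound on the extended nonnegative conditional expectation into
  integrability and a bound on the mean.\<close>

lemma (in prob_space) integrable_of_nn_cond_exp_le:
  fixes Y h :: "'a \<Rightarrow> real"
  assumes sub: "subalgebra M F" and Y: "Y \<in> borel_measurable M" "\<And>\<omega>. 0 \<le> Y \<omega>"
    and h: "integrable M h" "\<And>\<omega>. 0 \<le> h \<omega>"
    and le: "AE \<omega> in M. nn_cond_exp M F (\<lambda>\<omega>. ennreal (Y \<omega>)) \<omega> \<le> ennreal (h \<omega>)"
  shows "integrable M Y" "(\<integral>\<omega>. Y \<omega> \<partial>M) \<le> (\<integral>\<omega>. h \<omega> \<partial>M)"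
proof -
  interpret finite_measure_subalgebra M F using sub by unfold_locales
  have "(\<integral>\<^sup>+ \<omega>. ennreal (Y \<omega>) \<partial>M) = (\<integral>\<^sup>+ \<omega>. nn_cond_exp M F (\<lambda>\<omega>. ennreal (Y \<omega>)) \<omega> \<partial>M)"
    using nn_cond_exp_intg[of "\<lambda>_. 1" "\<lambda>\<omega>. ennreal (Y \<omega>)"]
      measurable_compose[OF Y(1) measurable_ennreal] by simp
  also have "\<dots> \<le> (\<integral>\<^sup>+ \<omega>. ennreal (h \<omega>) \<partial>M)" using le by (rule nn_integral_mono_AE)
  also have "\<dots> = ennreal (\<integral>\<omega>. h \<omega> \<partial>M)"
    by (rule nn_integral_eq_integral[OF h(1)]) (use h(2) in auto)
  finally have *: "(\<integral>\<^sup>+ \<omega>. ennreal (Y \<omega>) \<partial>M) \<le> ennreal (\<integral>\<omega>. h \<omega> \<partial>M)" .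
  have "(\<integral>\<^sup>+ \<omega>. ennreal (Y \<omega>) \<partial>M) < \<infinity>"
    using * by (rule le_less_trans) simp
  then show int: "integrable M Y" using Y by (intro integrableI_nonneg AE_I2)
  have "ennreal (\<integral>\<omega>. Y \<omega> \<partial>M) = (\<integral>\<^sup>+ \<omega>. ennreal (Y \<omega>) \<partial>M)"
    by (rule nn_integral_eq_integral[symmetric]) (use int Y(2) in auto)
  with * have "ennreal (\<integral>\<omega>. Y \<omega> \<partial>M) \<le> ennreal (\<integral>\<omega>. h \<omega> \<partial>M)" by simp
  moreover have "0 \<le> (\<integral>\<omega>. h \<omega> \<partial>M)" using h(2) by (rule Bochner_Integration.integral_nonneg)
  ultimately show "(\<integral>\<omega>. Y \<omega> \<partial>M) \<le> (\<integral>\<omega>. h \<omega> \<partial>M)" by (simp only: ennreal_le_iff)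
qed

lemma AE_summable_of_summable_integrals:
  fixes Y :: "nat \<Rightarrow> 'a \<Rightarrow> real"
  assumes int: "\<And>t. integrable M (Y t)" and nonneg: "\<And>t \<omega>. 0 \<le> Y t \<omega>"
    and sum: "summable (\<lambda>t. \<integral>\<omega>. Y t \<omega> \<partial>M)"
  shows "AE \<omega> in M. summable (\<lambda>t. Y t \<omega>)"
proof -
  have meas: "(\<lambda>\<omega>. ennreal (Y t \<omega>)) \<in> borel_measurable M" for t
    using borel_measurable_integrable[OF int] by (rule measurable_compose) simp
  have eq: "(\<integral>\<^sup>+ \<omega>. ennreal (Y t \<omega>) \<partial>M) = ennreal (\<integral>\<omega>. Y t \<omega> \<partial>M)" for t
    by (rule nn_integral_eq_integral[OF int]) (simp add: nonneg)
  have nonneg_int: "0 \<le> (\<integral>\<omega>. Y t \<omega> \<partial>M)" for t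
    using nonneg by (rule Bochner_Integration.integral_nonneg)
  have "(\<integral>\<^sup>+ \<omega>. (\<Sum>t. ennreal (Y t \<omega>)) \<partial>M) = (\<Sum>t. ennreal (\<integral>\<omega>. Y t \<omega> \<partial>M))"
    unfolding eq[symmetric] by (rule nn_integral_suminf[OF meas])
  also have "\<dots> = ennreal (\<Sum>t. \<integral>\<omega>. Y t \<omega> \<partial>M)"
    by (rule suminf_ennreal2[OF nonneg_int sum])
  finally have "(\<integral>\<^sup>+ \<omega>. (\<Sum>t. ennreal (Y t \<omega>)) \<partial>M) \<noteq> \<infinity>" by simp
  then have "AE \<omega> in M. (\<Sum>t. ennreal (Y t \<omega>)) \<noteq> \<infinity>"
    by (rule nn_integral_PInf_AE[rotated]) (intro borel_measurable_suminf_order meas)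
  then show ?thesis
  proof eventually_elim
    case (elim \<omega>)
    then show ?case using summable_suminf_not_top[of "\<lambda>t. Y t \<omega>"] nonneg by simp
  qed
qed

text \<open>Almost sure convergence passes to the means because the second moments are bounded: truncate
  at a level \<open>K\<close>. The truncated means tend to zero by dominated convergence, and the part above \<open>K\<close>
  contributes at most \<open>B / K\<close>, since \<open>Y \<le> Y\<^sup>2 / K\<close> there.\<close>

lemma (in prob_space) expectation_tendsto_zero:
  fixes Y :: "nat \<Rightarrow> 'a \<Rightarrow> real"
  assumes meas: "\<And>t. Y t \<in> borel_measurable M" and nonneg: "\<And>t \<omega>. 0 \<le> Y t \<omega>"
    and int: "\<And>t. integrable M (\<lambda>\<omega>. (Y t \<omega>)\<^sup>2)"
    and bound: "\<And>t. (\<integral>\<omega>. (Y t \<omega>)\<^sup>2 \<partial>M) \<le> B"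
    and AE: "AE \<omega> in M. (\<lambda>t. Y t \<omega>) \<longlonglongrightarrow> 0"
  shows "(\<lambda>t. \<integral>\<omega>. Y t \<omega> \<partial>M) \<longlonglongrightarrow> 0"
proof (rule LIMSEQ_I)
  fix \<epsilon> :: real assume "\<epsilon> > 0"
  define K where "K = 2 * (\<bar>B\<bar> + 1) / \<epsilon>"
  have "K > 0" unfolding K_def using \<open>\<epsilon> > 0\<close> by simp
  have K: "(1 / K) * \<bar>B\<bar> < \<epsilon> / 2"
    unfolding K_def using \<open>\<epsilon> > 0\<close> by (simp add: field_simps)
  have meas_min: "(\<lambda>\<omega>. min (Y t \<omega>) K) \<in> borel_measurable M" for t
    using meas by simp
  have "(\<lambda>t. \<integral>\<omega>. min (Y t \<omega>) K \<partial>M) \<longlonglongrightarrow> (\<integral>\<omega>. 0 \<partial>M)"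
  proof (rule integral_dominated_convergence[where w = "\<lambda>_. K"])
    show "AE \<omega> in M. (\<lambda>t. min (Y t \<omega>) K) \<longlonglongrightarrow> 0"
      using AE
    proof eventually_elim
      case (elim \<omega>)
      from tendsto_min[OF elim tendsto_const[of K]] \<open>K > 0\<close> show ?case by simp
    qed
    show "AE \<omega> in M. norm (min (Y t \<omega>) K) \<le> K" for t
      using nonneg[of t] \<open>K > 0\<close> by simp
  qed (use meas_min in simp_all)
  then have "(\<lambda>t. \<integral>\<omega>. min (Y t \<omega>) K \<partial>M) \<longlonglongrightarrow> 0" by simp
  then obtain N where N: "\<And>t. t \<ge> N \<Longrightarrow> norm (\<integral>\<omega>. min (Y t \<omega>) K \<partial>M) < \<epsilon> / 2"
    using \<open>\<epsilon> > 0\<close> by (metis LIMSEQ_D diff_zero half_gt_zero)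
  have "norm ((\<integral>\<omega>. Y t \<omega> \<partial>M) - 0) < \<epsilon>" if "t \<ge> N" for t
  proof -
    have split: "Y t \<omega> \<le> min (Y t \<omega>) K + (1 / K) * (Y t \<omega>)\<^sup>2" for \<omega>
    proof (cases "Y t \<omega> \<le> K")
      case False
      then have "K * Y t \<omega> \<le> Y t \<omega> * Y t \<omega>" using nonneg by (intro mult_right_mono) simp_all
      then have "Y t \<omega> \<le> (1 / K) * (Y t \<omega>)\<^sup>2"
        using \<open>K > 0\<close> by (simp add: field_simps power2_eq_square)
      with False \<open>K > 0\<close> show ?thesis by simp
    qed (use \<open>K > 0\<close> in simp)
    have int_min: "integrable M (\<lambda>\<omega>. min (Y t \<omega>) K)"
      using nonneg[of t] \<open>K > 0\<close> by (intro integrable_const_bound[where B = K] meas_min) simp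
    have "integrable M (Y t)"
    proof (rule Bochner_Integration.integrable_bound)
      show "integrable M (\<lambda>\<omega>. min (Y t \<omega>) K + (1 / K) * (Y t \<omega>)\<^sup>2)"
        by (intro Bochner_Integration.integrable_add int_min integrable_mult_right int)
      show "AE \<omega> in M. norm (Y t \<omega>) \<le> norm (min (Y t \<omega>) K + (1 / K) * (Y t \<omega>)\<^sup>2)"
      proof (rule AE_I2)
        fix \<omega>
        show "norm (Y t \<omega>) \<le> norm (min (Y t \<omega>) K + (1 / K) * (Y t \<omega>)\<^sup>2)"
          unfolding real_norm_def using split[of \<omega>] nonneg[of t \<omega>] by linarith
      qed
    qed (rule meas)
    then have "(\<integral>\<omega>. Y t \<omega> \<partial>M) \<le> (\<integral>\<omega>. min (Y t \<omega>) K + (1 / K) * (Y t \<omega>)\<^sup>2 \<partial>M)"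
      by (intro integral_mono split Bochner_Integration.integrable_add int_min
          integrable_mult_right int)
    also have "\<dots> = (\<integral>\<omega>. min (Y t \<omega>) K \<partial>M) + (1 / K) * (\<integral>\<omega>. (Y t \<omega>)\<^sup>2 \<partial>M)"
      using int_min int[of t] by simp
    also have "(1 / K) * (\<integral>\<omega>. (Y t \<omega>)\<^sup>2 \<partial>M) \<le> (1 / K) * \<bar>B\<bar>"
      using bound[of t] \<open>K > 0\<close> by (intro mult_left_mono) simp_all
    finally have "(\<integral>\<omega>. Y t \<omega> \<partial>M) < \<epsilon>"
      using N[OF that] K unfolding real_norm_def by linarith
    moreover have "0 \<le> (\<integral>\<omega>. Y t \<omega> \<partial>M)"
      by (rule Bochner_Integration.integral_nonneg) (rule nonneg)
    ultimately show ?thesis by simp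
  qed
  then show "\<exists>N. \<forall>t\<ge>N. norm ((\<integral>\<omega>. Y t \<omega> \<partial>M) - 0) < \<epsilon>" by blast
qed

section \<open>Almost sure convergence of square-integrable martingales\<close>

text \<open>For the maximal inequality: partial sums of \<open>m\<close> that freeze once their norm has reached \<open>\<epsilon>\<close>.\<close>

primrec frozen_sum :: "real \<Rightarrow> (nat \<Rightarrow> 'w \<Rightarrow> 'a::real_normed_vector) \<Rightarrow> nat \<Rightarrow> 'w \<Rightarrow> 'a" where
  "frozen_sum \<epsilon> m 0 \<omega> = 0"
| "frozen_sum \<epsilon> m (Suc k) \<omega> =
     frozen_sum \<epsilon> m k \<omega> + (if norm (frozen_sum \<epsilon> m k \<omega>) < \<epsilon> then m k \<omega> else 0)"

lemma frozen_sum_detects: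
  assumes "j \<le> k" "\<epsilon> \<le> norm (\<Sum>t<j. m t \<omega>)"
  shows "\<epsilon> \<le> norm (frozen_sum \<epsilon> m k \<omega>)"
proof (rule ccontr)
  have active: "frozen_sum \<epsilon> m j \<omega> = (\<Sum>t<j. m t \<omega>) \<and> norm (\<Sum>t<j. m t \<omega>) < \<epsilon>"
    if "norm (frozen_sum \<epsilon> m k \<omega>) < \<epsilon>" "j \<le> k" for j k
    using that
  proof (induction k arbitrary: j)
    case (Suc k)
    have "norm (frozen_sum \<epsilon> m k \<omega>) < \<epsilon>"
    proof (rule ccontr)
      assume "\<not> norm (frozen_sum \<epsilon> m k \<omega>) < \<epsilon>"
      then show False using Suc.prems(1) by simp
    qed
    then show ?case using Suc.IH[of k] Suc.IH[of j] Suc.prems by (cases "j = Suc k") auto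
  qed simp
  assume "\<not> ?thesis"
  with active[of k j] assms show False by simp
qed

text \<open>The last assumption expresses \<open>E[m t | H t] = 0\<close> by testing against square-integrable vectors
  that are known at time \<open>t\<close>, which avoids vector-valued conditional expectations.\<close>

locale martingale_differences = prob_space M for M :: "'w measure" +
  fixes H :: "nat \<Rightarrow> 'w measure" and m :: "nat \<Rightarrow> 'w \<Rightarrow> 'a::euclidean_space"
  assumes sub: "\<And>t. subalgebra M (H t)" and incr: "\<And>t. subalgebra (H (Suc t)) (H t)"
    and adapted: "\<And>t. m t \<in> borel_measurable (H (Suc t))"
    and sq_int: "\<And>t. square_integrable M (m t)"
    and orth: "\<And>t Z. Z \<in> borel_measurable (H t) \<Longrightarrow> square_integrable M Z \<Longrightarrow>
                 (\<integral>\<omega>. Z \<omega> \<bullet> m t \<omega> \<partial>M) = 0"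
begin

lemma shift: "martingale_differences M (\<lambda>t. H (N + t)) (\<lambda>t. m (N + t))"
  by unfold_locales (use sub incr adapted sq_int orth in auto)

lemma frozen_sum_properties:
  "frozen_sum \<epsilon> m k \<in> borel_measurable (H k) \<and> square_integrable M (frozen_sum \<epsilon> m k) \<and>
   (\<integral>\<omega>. (norm (frozen_sum \<epsilon> m k \<omega>))\<^sup>2 \<partial>M) \<le> (\<Sum>t<k. \<integral>\<omega>. (norm (m t \<omega>))\<^sup>2 \<partial>M)"
proof (induction k)
  case 0
  then show ?case by (simp add: square_integrable_def)
next
  case (Suc k)
  define T where "T = frozen_sum \<epsilon> m k"
  define Z where "Z \<omega> = (if norm (T \<omega>) < \<epsilon> then T \<omega> else 0)" for \<omega>
  define d where "d \<omega> = (if norm (T \<omega>) < \<epsilon> then m k \<omega> else 0)" for \<omega>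
  have T: "T \<in> borel_measurable (H k)" "square_integrable M T"
    using Suc unfolding T_def by auto
  have [measurable]: "T \<in> borel_measurable M" using T(2) by (rule square_integrable_measurable)
  have T': "T \<in> borel_measurable (H (Suc k))" using measurable_from_subalg[OF incr T(1)] .
  have [measurable]: "m k \<in> borel_measurable M" using sq_int by (rule square_integrable_measurable)
  have step: "frozen_sum \<epsilon> m (Suc k) \<omega> = T \<omega> + d \<omega>" for \<omega>
    by (simp add: T_def d_def)
  have Z_meas: "Z \<in> borel_measurable (H k)"
  proof -
    note [measurable] = T(1)
    show ?thesis unfolding Z_def by measurable
  qed
  have d_meas: "d \<in> borel_measurable (H (Suc k))"
  proof -
    note [measurable] = T' adapted
    show ?thesis unfolding d_def by measurable
  qed
  have Z: "square_integrable M Z"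
    by (rule square_integrable_dominated[OF _ square_integrableD[OF T(2)]])
      (use measurable_from_subalg[OF sub Z_meas] in \<open>auto simp: Z_def\<close>)
  have d: "square_integrable M d"
    by (rule square_integrable_dominated[OF _ square_integrableD[OF sq_int[of k]]])
      (use measurable_from_subalg[OF sub d_meas] in \<open>auto simp: d_def\<close>)
  have "T \<omega> \<bullet> d \<omega> = Z \<omega> \<bullet> m k \<omega>" for \<omega> by (simp add: Z_def d_def)
  then have "(\<integral>\<omega>. T \<omega> \<bullet> d \<omega> \<partial>M) = 0" using orth[OF Z_meas Z] by simp
  then have "(\<integral>\<omega>. (norm (T \<omega> + d \<omega>))\<^sup>2 \<partial>M) = (\<integral>\<omega>. (norm (T \<omega>))\<^sup>2 \<partial>M) + (\<integral>\<omega>. (norm (d \<omega>))\<^sup>2 \<partial>M)"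
    by (rule second_moment_add[OF T(2) d])
  also have "(\<integral>\<omega>. (norm (d \<omega>))\<^sup>2 \<partial>M) \<le> (\<integral>\<omega>. (norm (m k \<omega>))\<^sup>2 \<partial>M)"
    using square_integrableD[OF d] square_integrableD[OF sq_int]
    by (intro integral_mono) (auto simp: d_def)
  finally have bound: "(\<integral>\<omega>. (norm (T \<omega> + d \<omega>))\<^sup>2 \<partial>M) \<le> (\<Sum>t<Suc k. \<integral>\<omega>. (norm (m t \<omega>))\<^sup>2 \<partial>M)"
    using Suc unfolding T_def by simp
  have fun_eq: "frozen_sum \<epsilon> m (Suc k) = (\<lambda>\<omega>. T \<omega> + d \<omega>)" using step by auto
  show ?case
    unfolding fun_eq using bound T' d_meas square_integrable_add[OF T(2) d] by auto
qed

text \<open>Kolmogorov's maximal inequality: the event that some partial sum reaches norm \<open>\<epsilon>\<close> is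
  visible in the final value of the frozen sum, whose second moment Markov's inequality uses.
  Freezing keeps the increments orthogonal to the past.\<close>

lemma maximal_inequality:
  assumes "\<epsilon> > 0" and B: "\<And>k. (\<Sum>t<k. \<integral>\<omega>. (norm (m t \<omega>))\<^sup>2 \<partial>M) \<le> B"
  shows "{\<omega> \<in> space M. \<exists>j. \<epsilon> \<le> norm (\<Sum>t<j. m t \<omega>)} \<in> events"
    and "prob {\<omega> \<in> space M. \<exists>j. \<epsilon> \<le> norm (\<Sum>t<j. m t \<omega>)} \<le> B / \<epsilon>\<^sup>2"
proof -
  have [measurable]: "m t \<in> borel_measurable M" for t
    using sq_int by (rule square_integrable_measurable)
  define A where "A k = {\<omega> \<in> space M. \<exists>j\<le>k. \<epsilon> \<le> norm (\<Sum>t<j. m t \<omega>)}" for k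
  have A: "A k \<in> events" for k unfolding A_def by measurable
  have Un: "{\<omega> \<in> space M. \<exists>j. \<epsilon> \<le> norm (\<Sum>t<j. m t \<omega>)} = (\<Union>k. A k)"
    unfolding A_def by auto
  show "{\<omega> \<in> space M. \<exists>j. \<epsilon> \<le> norm (\<Sum>t<j. m t \<omega>)} \<in> events" by measurable
  have "incseq A" unfolding A_def by (intro monoI) (auto intro: order_trans)
  then have lim: "(\<lambda>k. prob (A k)) \<longlonglongrightarrow> prob (\<Union>k. A k)"
    using A by (intro finite_Lim_measure_incseq) auto
  have "prob (A k) \<le> B / \<epsilon>\<^sup>2" for k
  proof -
    define T where "T = frozen_sum \<epsilon> m k"
    have T: "square_integrable M T" "(\<integral>\<omega>. (norm (T \<omega>))\<^sup>2 \<partial>M) \<le> B"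
      using frozen_sum_properties[of \<epsilon> k] B[of k] unfolding T_def by auto
    have [measurable]: "T \<in> borel_measurable M" using T(1) by (rule square_integrable_measurable)
    have "\<epsilon>\<^sup>2 \<le> (norm (T \<omega>))\<^sup>2" if "\<omega> \<in> A k" for \<omega>
      using that frozen_sum_detects[of _ k \<epsilon> m \<omega>] \<open>\<epsilon> > 0\<close> unfolding A_def T_def
      by (auto intro!: power_mono)
    then have "prob (A k) \<le> prob {\<omega> \<in> space M. \<epsilon>\<^sup>2 \<le> (norm (T \<omega>))\<^sup>2}"
      by (intro finite_measure_mono) (auto simp: A_def)
    also have "\<dots> \<le> (\<integral>\<omega>. (norm (T \<omega>))\<^sup>2 \<partial>M) / \<epsilon>\<^sup>2"
      using \<open>\<epsilon> > 0\<close> square_integrableD[OF T(1)] by (intro integral_Markov_inequality_measure[where A = "{}"]) auto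
    also have "\<dots> \<le> B / \<epsilon>\<^sup>2" using T(2) \<open>\<epsilon> > 0\<close> by (intro divide_right_mono) auto
    finally show ?thesis .
  qed
  with lim show "prob {\<omega> \<in> space M. \<exists>j. \<epsilon> \<le> norm (\<Sum>t<j. m t \<omega>)} \<le> B / \<epsilon>\<^sup>2"
    unfolding Un by (intro LIMSEQ_le_const2) auto
qed

end

text \<open>The maximal inequality applied to the increments from time \<open>N\<close> on bounds the probability of a
  later fluctuation of size \<open>\<epsilon>\<close> by a tail of the series of second moments. Hence almost surely some
  \<open>N\<close> stops all fluctuations of size \<open>\<epsilon>\<close>, and the partial sums are Cauchy.\<close>

theorem (in martingale_differences) AE_convergent_sum:
  assumes sum: "summable (\<lambda>t. \<integral>\<omega>. (norm (m t \<omega>))\<^sup>2 \<partial>M)"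
  shows "AE \<omega> in M. convergent (\<lambda>T. \<Sum>t<T. m t \<omega>)"
proof -
  define s where "s t = (\<integral>\<omega>. (norm (m t \<omega>))\<^sup>2 \<partial>M)" for t
  have s0: "0 \<le> s t" for t unfolding s_def by (simp add: Bochner_Integration.integral_nonneg)
  define E where "E \<epsilon> N = {\<omega> \<in> space M. \<exists>j. \<epsilon> \<le> norm (\<Sum>t<j. m (N + t) \<omega>)}" for \<epsilon> N
  have E: "E \<epsilon> N \<in> events \<and> prob (E \<epsilon> N) \<le> (\<Sum>t. s (t + N)) / \<epsilon>\<^sup>2" if "\<epsilon> > 0" for \<epsilon> N
  proof -
    interpret shifted: martingale_differences M "\<lambda>t. H (N + t)" "\<lambda>t. m (N + t)" by (rule shift)
    have "(\<Sum>t<k. \<integral>\<omega>. (norm (m (N + t) \<omega>))\<^sup>2 \<partial>M) \<le> (\<Sum>t. s (t + N))" for k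
    proof -
      have "summable (\<lambda>t. s (t + N))"
        using sum unfolding s_def[symmetric] by (rule summable_ignore_initial_segment)
      then have "(\<Sum>t<k. s (t + N)) \<le> (\<Sum>t. s (t + N))"
        by (rule sum_le_suminf) (auto simp: s0)
      then show ?thesis unfolding s_def by (simp add: add.commute)
    qed
    then show ?thesis
      using shifted.maximal_inequality[OF that] unfolding E_def by blast
  qed
  have null: "(\<Inter>N. E \<epsilon> N) \<in> null_sets M" if "\<epsilon> > 0" for \<epsilon>
  proof -
    have "(\<lambda>N. (\<Sum>t. s (t + N)) / \<epsilon>\<^sup>2) \<longlonglongrightarrow> 0 / \<epsilon>\<^sup>2"
      using sum that unfolding s_def[symmetric] by (intro tendsto_divide suminf_exist_split2) auto
    moreover have "prob (\<Inter>N. E \<epsilon> N) \<le> (\<Sum>t. s (t + N)) / \<epsilon>\<^sup>2" for N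
    proof -
      have "prob (\<Inter>N. E \<epsilon> N) \<le> prob (E \<epsilon> N)"
        using E[OF that] by (intro finite_measure_mono) auto
      with E[OF that, of N] show ?thesis by linarith
    qed
    ultimately have "prob (\<Inter>N. E \<epsilon> N) \<le> 0" by (intro LIMSEQ_le_const[of _ 0]) auto
    moreover have "(\<Inter>N. E \<epsilon> N) \<in> events" using E[OF that] by auto
    ultimately show ?thesis
      by (intro null_setsI) (auto simp: emeasure_eq_measure measure_le_0_iff)
  qed
  have "AE \<omega> in M. \<forall>i. \<exists>N. \<omega> \<notin> E (1 / real (Suc i)) N"
    unfolding AE_all_countable
  proof
    fix i
    have "(\<Inter>N. E (1 / real (Suc i)) N) \<in> null_sets M" by (rule null) simp
    then have "AE \<omega> in M. \<omega> \<notin> (\<Inter>N. E (1 / real (Suc i)) N)" by (rule AE_not_in)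
    then show "AE \<omega> in M. \<exists>N. \<omega> \<notin> E (1 / real (Suc i)) N" by eventually_elim blast
  qed
  then show ?thesis using AE_space
  proof eventually_elim
    case (elim \<omega>)
    have "Cauchy (\<lambda>T. \<Sum>t<T. m t \<omega>)"
    proof (rule metric_CauchyI)
      fix e :: real assume "e > 0"
      then obtain i where i: "1 / real (Suc i) < e / 2"
        using nat_approx_posE[of "e / 2"] by auto
      obtain N where "\<omega> \<notin> E (1 / real (Suc i)) N" using elim by blast
      then have small: "norm (\<Sum>t<j. m (N + t) \<omega>) < e / 2" for j
      proof -
        have "norm (\<Sum>t<j. m (N + t) \<omega>) < 1 / real (Suc i)"
          using \<open>\<omega> \<notin> E (1 / real (Suc i)) N\<close> elim(2) unfolding E_def by (auto simp: not_le)
        with i show ?thesis by linarith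
      qed
      have dist: "dist (\<Sum>t<T. m t \<omega>) (\<Sum>t<N. m t \<omega>) < e / 2" if "T \<ge> N" for T
      proof -
        have "(\<Sum>t<N + k. m t \<omega>) = (\<Sum>t<N. m t \<omega>) + (\<Sum>t<k. m (N + t) \<omega>)" for k
          by (induction k) (simp_all add: add_ac)
        from this[of "T - N"] small[of "T - N"] that show ?thesis by (simp add: dist_norm)
      qed
      have "dist (\<Sum>t<a. m t \<omega>) (\<Sum>t<b. m t \<omega>) < e" if "a \<ge> N" "b \<ge> N" for a b
        using dist[OF that(1)] dist[OF that(2)] by (rule dist_triangle_half_l)
      then show "\<exists>N. \<forall>a\<ge>N. \<forall>b\<ge>N. dist (\<Sum>t<a. m t \<omega>) (\<Sum>t<b. m t \<omega>) < e" by blast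
    qed
    then show ?case by (rule Cauchy_convergent)
  qed
qed

section \<open>Moments of the local iterates\<close>

locale fedavg_process = prob_space M for M :: "'w measure" +
  fixes F :: "nat \<Rightarrow> nat \<Rightarrow> 'w measure"
    and f :: "nat \<Rightarrow> real ^ 'p \<Rightarrow> real"
    and g :: "nat \<Rightarrow> real ^ 'p \<Rightarrow> 's \<Rightarrow> real ^ 'p"
    and \<xi> :: "nat \<Rightarrow> nat \<Rightarrow> nat \<Rightarrow> 'w \<Rightarrow> 's"
    and \<alpha> :: "nat \<Rightarrow> real"
    and x0 :: "real ^ 'p"
    and n Q :: nat
    and C D L :: real
  assumes n: "n \<ge> 1" and Q: "Q \<ge> 1" and L: "L > 0"
    and smooth: "\<And>i. i \<in> {1..n} \<Longrightarrow> L_smooth L (f i)"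
    and bounded: "\<And>i. i \<in> {1..n} \<Longrightarrow> bdd_below (range (f i))"
    and abc: "ABC_assumption M F C D n Q f g \<xi> \<alpha> x0"
    and pos: "\<And>t. \<alpha> t > 0"
    and sq: "summable (\<lambda>t. (\<alpha> t)\<^sup>2)"
begin

abbreviation x :: "nat \<Rightarrow> 'w \<Rightarrow> real ^ 'p" where
  "x t \<equiv> fedavg n Q g \<xi> \<alpha> x0 t"

abbreviation X :: "nat \<Rightarrow> nat \<Rightarrow> nat \<Rightarrow> 'w \<Rightarrow> real ^ 'p" where
  "X i t l \<equiv> local_iterate n Q g \<xi> \<alpha> x0 i t l"

abbreviation G :: "nat \<Rightarrow> nat \<Rightarrow> nat \<Rightarrow> 'w \<Rightarrow> real ^ 'p" where
  "G i t l \<equiv> stoch_grad n Q g \<xi> \<alpha> x0 i t l"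

abbreviation favg :: "real ^ 'p \<Rightarrow> real" where
  "favg \<equiv> avg_fun n f"

definition noise :: "nat \<Rightarrow> nat \<Rightarrow> nat \<Rightarrow> 'w \<Rightarrow> real ^ 'p" where
  "noise i t l \<omega> = G i t l \<omega> - gradient (f i) (X i t l \<omega>)"

text \<open>The average of the \<open>n\<close> infima: a lower bound of \<open>favg\<close>, in general smaller than its
  infimum. It is the right reference value because the noise of agent \<open>i\<close> is controlled by
  \<open>f i - inf_val (f i)\<close>, and these gaps add up to \<open>n * (favg - lower_val)\<close>.\<close>

definition lower_val :: real where
  "lower_val = (1 / real n) * (\<Sum>i = 1..n. inf_val (f i))"

definition mean_gap :: "nat \<Rightarrow> real" where
  "mean_gap t = (\<integral>\<omega>. favg (x t \<omega>) - lower_val \<partial>M)"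

lemma C_D_nonneg: "0 \<le> C" "0 \<le> D"
  and sub: "l < Q \<Longrightarrow> subalgebra M (F t l)"
  and sub_step: "Suc l < Q \<Longrightarrow> subalgebra (F t (Suc l)) (F t l)"
  and sub_round: "subalgebra (F (Suc t) 0) (F t (Q - 1))"
  and X_measurable: "i \<in> {1..n} \<Longrightarrow> l < Q \<Longrightarrow> X i t l \<in> borel_measurable (F t l)"
  and G_measurable_next_round: "i \<in> {1..n} \<Longrightarrow> l < Q \<Longrightarrow> G i t l \<in> borel_measurable (F (Suc t) l)"
  and abc_iterate: "i \<in> {1..n} \<Longrightarrow> l < Q \<Longrightarrow> abc_at M (F t l) C D (f i) (X i t l) (G i t l)"
  using abc unfolding ABC_assumption_def by blast+

lemma G_measurable: "i \<in> {1..n} \<Longrightarrow> l < Q \<Longrightarrow> G i t l \<in> borel_measurable M"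
  using measurable_from_subalg[OF sub G_measurable_next_round] .

lemma sub_within_round:
  assumes "l \<le> l'" "l' < Q"
  shows "subalgebra (F t l') (F t l)"
  using assms
proof (induction l' rule: dec_induct)
  case base
  then show ?case by (simp add: subalgebra_def)
next
  case (step k)
  then show ?case using sub_step[of k t] by (auto simp: subalgebra_def)
qed

lemma sub_next_round:
  assumes "l < Q"
  shows "subalgebra (F (Suc t) 0) (F t l)"
proof -
  have "subalgebra (F t (Q - 1)) (F t l)" using assms by (intro sub_within_round) auto
  then show ?thesis using sub_round[of t] by (auto simp: subalgebra_def)
qed

lemma X_0: "X i t 0 = x t"
  by (simp add: local_iterate_def fun_eq_iff)

lemma X_Suc: "X i t (Suc l) \<omega> = X i t l \<omega> - \<alpha> t *\<^sub>R G i t l \<omega>"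
  by (simp add: local_iterate_def stoch_grad_def)

lemma X_eq: "X i t l \<omega> = x t \<omega> - \<alpha> t *\<^sub>R (\<Sum>k<l. G i t k \<omega>)"
  by (induction l) (simp_all add: X_0 X_Suc scaleR_add_right del: fedavg.simps)

lemma x_Suc: "x (Suc t) \<omega> = (1 / real n) *\<^sub>R (\<Sum>i = 1..n. X i t Q \<omega>)"
  by (simp add: local_iterate_def)

lemma x_measurable: "x t \<in> borel_measurable (F t 0)"
  using X_measurable[of 1 0 t] n Q by (simp add: X_0 del: fedavg.simps)

lemma inf_val_le: "i \<in> {1..n} \<Longrightarrow> inf_val (f i) \<le> f i y"
  unfolding inf_val_def using bounded by (intro cINF_lower) auto

lemma favg_smooth: "L_smooth L favg"
  using n smooth by (rule L_smooth_avg_fun)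

lemma gap_sum: "(\<Sum>i = 1..n. f i y - inf_val (f i)) = real n * (favg y - lower_val)"
  using n by (simp add: avg_fun_def lower_val_def sum_subtractf right_diff_distrib)

lemma lower_val_le: "lower_val \<le> favg y"
proof -
  have "0 \<le> (\<Sum>i = 1..n. f i y - inf_val (f i))"
    using inf_val_le by (intro sum_nonneg) auto
  then show ?thesis unfolding gap_sum using n by (simp add: zero_le_mult_iff)
qed

lemma agent_gap_le:
  assumes "i \<in> {1..n}"
  shows "f i y - inf_val (f i) \<le> real n * (favg y - lower_val)"
proof -
  have "f i y - inf_val (f i) \<le> (\<Sum>i = 1..n. f i y - inf_val (f i))"
  proof (rule member_le_sum[OF assms])
    show "0 \<le> f j y - inf_val (f j)" if "j \<in> {1..n} - {i}" for j
      using inf_val_le[of j y] that by simp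
  qed simp
  then show ?thesis by (simp only: gap_sum)
qed

lemma square_integrable_gradient:
  assumes "L_smooth L \<phi>" "square_integrable M Y"
  shows "square_integrable M (\<lambda>\<omega>. gradient \<phi> (Y \<omega> :: real ^ 'p))"
  by (rule square_integrable_lipschitz_image[OF L_smoothD(2)[OF assms(1)] less_imp_le[OF L] assms(2)])

lemma integrable_agent_gap:
  assumes "i \<in> {1..n}" "square_integrable M Y"
  shows "integrable M (\<lambda>\<omega>. f i (Y \<omega>) - inf_val (f i))"
  using integrable_L_smooth[OF smooth[OF assms(1)] inf_val_le[OF assms(1)] assms(2)] by simp

lemma integrable_gap:
  assumes "square_integrable M Y"
  shows "integrable M (\<lambda>\<omega>. favg (Y \<omega>) - lower_val)"
  using integrable_L_smooth[OF favg_smooth lower_val_le assms] by simp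

lemma mean_gap_nonneg: "0 \<le> mean_gap t"
  unfolding mean_gap_def
  by (rule Bochner_Integration.integral_nonneg) (simp add: lower_val_le)

text \<open>The square integrability of the noise is part of the conclusion: it follows from the conditional
  variance bound once the iterate is square integrable, so the two properties pass back and forth
  along the recursion.\<close>

lemma noise_moment:
  assumes i: "i \<in> {1..n}" and l: "l < Q" and X: "square_integrable M (X i t l)"
  shows "square_integrable M (noise i t l)"
    and "(\<integral>\<omega>. (norm (noise i t l \<omega>))\<^sup>2 \<partial>M) \<le> C * (\<integral>\<omega>. f i (X i t l \<omega>) - inf_val (f i) \<partial>M) + D"
proof -
  define h where "h \<omega> = C * (f i (X i t l \<omega>) - inf_val (f i)) + D" for \<omega>
  have h: "integrable M h" "\<And>\<omega>. 0 \<le> h \<omega>"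
    unfolding h_def using integrable_agent_gap[OF i X] C_D_nonneg inf_val_le[OF i]
    by (simp_all add: integrable_mult_right)
  have meas: "noise i t l \<in> borel_measurable M"
    unfolding noise_def using G_measurable[OF i l]
      square_integrable_measurable[OF square_integrable_gradient[OF smooth[OF i] X]]
    by (intro borel_measurable_diff)
  have "AE \<omega> in M. nn_cond_exp M (F t l) (\<lambda>\<omega>'. ennreal ((norm (noise i t l \<omega>'))\<^sup>2)) \<omega> \<le> ennreal (h \<omega>)"
    using abc_iterate[OF i l] unfolding abc_at_def noise_def h_def by blast
  note * = integrable_of_nn_cond_exp_le[OF sub[OF l] _ _ h this]
  have meas_sq: "(\<lambda>\<omega>. (norm (noise i t l \<omega>))\<^sup>2) \<in> borel_measurable M"
    using meas by simp
  have "integrable M (\<lambda>\<omega>. (norm (noise i t l \<omega>))\<^sup>2)"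
    by (rule *(1)[OF meas_sq zero_le_power2])
  then show "square_integrable M (noise i t l)"
    using meas unfolding square_integrable_def by blast
  have "(\<integral>\<omega>. (norm (noise i t l \<omega>))\<^sup>2 \<partial>M) \<le> (\<integral>\<omega>. h \<omega> \<partial>M)"
    by (rule *(2)[OF meas_sq zero_le_power2])
  also have "\<dots> = C * (\<integral>\<omega>. f i (X i t l \<omega>) - inf_val (f i) \<partial>M) + D"
    unfolding h_def using integrable_agent_gap[OF i X] by (simp add: prob_space)
  finally show "(\<integral>\<omega>. (norm (noise i t l \<omega>))\<^sup>2 \<partial>M)
      \<le> C * (\<integral>\<omega>. f i (X i t l \<omega>) - inf_val (f i) \<partial>M) + D" .
qed

lemma G_eq: "G i t l \<omega> = gradient (f i) (X i t l \<omega>) + noise i t l \<omega>"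
  by (simp add: noise_def)

text \<open>The constants of this section only have to be independent of the round and of the agent. This
  one collects the factors of the proof of \<open>stoch_grad_moment\<close>: \<open>4 * L\<close> from the true gradient
  and \<open>2 * C\<close> from the noise, each times the gap of agent \<open>i\<close> at the local iterate, which is at
  most \<open>(1 + L) * n * (mean_gap t + \<delta>)\<close> in the mean.\<close>

definition grad_const :: real where
  "grad_const = (4 * L + 2 * C) * (1 + L) * real n + 2 * D"

lemma grad_const_nonneg: "0 \<le> grad_const"
  unfolding grad_const_def using L C_D_nonneg by simp

text \<open>Both the true gradient and the noise are controlled by the gap of agent \<open>i\<close> at its local
  iterate. Smoothness moves this gap back to the start of the round at the price of the squared
  displacement \<open>\<delta>\<close>.\<close>

lemma stoch_grad_moment:
  assumes i: "i \<in> {1..n}" and l: "l < Q"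
    and x: "square_integrable M (x t)" and X: "square_integrable M (X i t l)"
  defines "\<delta> \<equiv> (\<integral>\<omega>. (norm (X i t l \<omega> - x t \<omega>))\<^sup>2 \<partial>M)"
  shows "square_integrable M (G i t l)"
    and "(\<integral>\<omega>. (norm (G i t l \<omega>))\<^sup>2 \<partial>M) \<le> grad_const * (mean_gap t + 1 + \<delta>)"
    and "(\<integral>\<omega>. (norm (noise i t l \<omega>))\<^sup>2 \<partial>M) \<le> grad_const * (mean_gap t + 1 + \<delta>)"
proof -
  define a where "a = (\<integral>\<omega>. f i (X i t l \<omega>) - inf_val (f i) \<partial>M)"
  have diff: "square_integrable M (\<lambda>\<omega>. X i t l \<omega> - x t \<omega>)"
    using X x by (rule square_integrable_diff)
  have "0 \<le> \<delta>" unfolding \<delta>_def by (simp add: Bochner_Integration.integral_nonneg)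
  have "0 \<le> a" unfolding a_def
    using inf_val_le[OF i] by (intro Bochner_Integration.integral_nonneg) simp
  have pointwise: "f i y - inf_val (f i)
      \<le> (1 + L) * (real n * (favg z - lower_val)) + (1 + L) * (norm (y - z))\<^sup>2" for y z
  proof -
    have "f i y \<le> f i z + (y - z) \<bullet> gradient (f i) z + L / 2 * (norm (y - z))\<^sup>2"
      using smooth[OF i] by (rule L_smooth_upper_bound)
    moreover have "(y - z) \<bullet> gradient (f i) z \<le> (norm (y - z))\<^sup>2 / 2 + (norm (gradient (f i) z))\<^sup>2 / 2"
      by (rule inner_le_half_squares)
    moreover have "(norm (gradient (f i) z))\<^sup>2 \<le> 2 * L * (f i z - inf_val (f i))"
      using smooth[OF i] L inf_val_le[OF i] by (rule norm_gradient_sq_le_gap)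
    ultimately have "f i y - inf_val (f i)
        \<le> (1 + L) * (f i z - inf_val (f i)) + (1 + L) / 2 * (norm (y - z))\<^sup>2"
      by (simp add: field_simps)
    also have "\<dots> \<le> (1 + L) * (real n * (favg z - lower_val)) + (1 + L) * (norm (y - z))\<^sup>2"
      using L agent_gap_le[OF i, of z] by (intro add_mono mult_left_mono mult_right_mono) auto
    finally show ?thesis .
  qed
  have "a \<le> (\<integral>\<omega>. (1 + L) * (real n * (favg (x t \<omega>) - lower_val))
      + (1 + L) * (norm (X i t l \<omega> - x t \<omega>))\<^sup>2 \<partial>M)"
    unfolding a_def using integrable_gap[OF x] square_integrableD[OF diff]
    by (intro integral_mono integrable_agent_gap[OF i X] pointwise
        Bochner_Integration.integrable_add integrable_mult_right)
  also have "\<dots> = (1 + L) * (real n * mean_gap t) + (1 + L) * \<delta>"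
    unfolding mean_gap_def \<delta>_def using integrable_gap[OF x] square_integrableD[OF diff] by simp
  also have "\<dots> \<le> (1 + L) * (real n * mean_gap t) + (1 + L) * (real n * \<delta>)"
  proof -
    have "1 * \<delta> \<le> real n * \<delta>" using n \<open>0 \<le> \<delta>\<close> by (intro mult_right_mono) auto
    then show ?thesis using L by (intro add_left_mono mult_left_mono) auto
  qed
  finally have a: "a \<le> (1 + L) * real n * (mean_gap t + \<delta>)" by (simp add: algebra_simps)
  have "(4 * L + 2 * C) * a + 2 * D \<le> (4 * L + 2 * C) * ((1 + L) * real n * (mean_gap t + \<delta>)) + 2 * D"
    using a L C_D_nonneg by (intro add_right_mono mult_left_mono) auto
  also have "\<dots> \<le> grad_const * (mean_gap t + 1 + \<delta>)"
  proof -
    have "0 \<le> (4 * L + 2 * C) * ((1 + L) * real n)" using L C_D_nonneg by simp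
    moreover have "0 \<le> 2 * D * (mean_gap t + \<delta>)"
      using C_D_nonneg mean_gap_nonneg \<open>0 \<le> \<delta>\<close> by simp
    ultimately show ?thesis unfolding grad_const_def by (simp add: algebra_simps)
  qed
  finally have bound: "(4 * L + 2 * C) * a + 2 * D \<le> grad_const * (mean_gap t + 1 + \<delta>)" .
  have noise: "(\<integral>\<omega>. (norm (noise i t l \<omega>))\<^sup>2 \<partial>M) \<le> C * a + D"
    unfolding a_def by (rule noise_moment[OF i l X])
  have "0 \<le> 4 * L * a + C * a + D" using L C_D_nonneg \<open>0 \<le> a\<close> by simp
  with noise bound show "(\<integral>\<omega>. (norm (noise i t l \<omega>))\<^sup>2 \<partial>M) \<le> grad_const * (mean_gap t + 1 + \<delta>)"
    by (simp add: algebra_simps)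
  have grad: "square_integrable M (\<lambda>\<omega>. gradient (f i) (X i t l \<omega>))"
    using smooth[OF i] X by (rule square_integrable_gradient)
  show G: "square_integrable M (G i t l)"
    using square_integrable_add[OF grad noise_moment(1)[OF i l X]] by (simp flip: G_eq)
  have "(\<integral>\<omega>. (norm (G i t l \<omega>))\<^sup>2 \<partial>M)
      \<le> (\<integral>\<omega>. 2 * (2 * L * (f i (X i t l \<omega>) - inf_val (f i))) + 2 * (norm (noise i t l \<omega>))\<^sup>2 \<partial>M)"
  proof (rule integral_mono)
    fix \<omega>
    show "(norm (G i t l \<omega>))\<^sup>2
        \<le> 2 * (2 * L * (f i (X i t l \<omega>) - inf_val (f i))) + 2 * (norm (noise i t l \<omega>))\<^sup>2"
      unfolding G_eq
      using norm_add_sq_le[of "gradient (f i) (X i t l \<omega>)" "noise i t l \<omega>"]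
        norm_gradient_sq_le_gap[OF smooth[OF i] L inf_val_le[OF i], of "X i t l \<omega>"]
      by linarith
  qed (use square_integrableD[OF G] integrable_agent_gap[OF i X]
      square_integrableD[OF noise_moment(1)[OF i l X]] in auto)
  also have "\<dots> = 4 * L * a + 2 * (\<integral>\<omega>. (norm (noise i t l \<omega>))\<^sup>2 \<partial>M)"
    unfolding a_def
    using integrable_agent_gap[OF i X] square_integrableD[OF noise_moment(1)[OF i l X]] by simp
  also have "\<dots> \<le> (4 * L + 2 * C) * a + 2 * D" using noise by (simp add: algebra_simps)
  also note bound
  finally show "(\<integral>\<omega>. (norm (G i t l \<omega>))\<^sup>2 \<partial>M) \<le> grad_const * (mean_gap t + 1 + \<delta>)" .
qed

definition step_const :: real where
  "step_const = (\<Sum>t. (\<alpha> t)\<^sup>2)"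

lemma step_sq_le: "(\<alpha> t)\<^sup>2 \<le> step_const"
  unfolding step_const_def using sum_le_suminf[OF sq, of "{t}"] by simp

text \<open>One local step multiplies the bound on the squared displacement by at most \<open>2 * growth\<close>.\<close>

definition growth :: real where
  "growth = 2 + 2 * grad_const + 2 * step_const * grad_const"

lemma growth_ge: "2 \<le> growth"
  unfolding growth_def using grad_const_nonneg order_trans[OF zero_le_power2 step_sq_le] by simp

text \<open>Displacement and stochastic gradient bound each other in turn, so the induction over the local
  steps proves at the same time that the local iterates are square integrable. Since the
  displacement starts at zero and each step contributes a multiple of \<open>\<alpha> t\<close>, its second
  moment is of order \<open>(\<alpha> t)\<^sup>2\<close>.\<close>

lemma displacement_moment:
  assumes i: "i \<in> {1..n}" and l: "l \<le> Q" and x: "square_integrable M (x t)"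
  shows "square_integrable M (X i t l) \<and>
    (\<integral>\<omega>. (norm (X i t l \<omega> - x t \<omega>))\<^sup>2 \<partial>M) \<le> (2 * growth) ^ l * ((\<alpha> t)\<^sup>2 * (mean_gap t + 1))"
  using l
proof (induction l)
  case 0
  then show ?case
    using x mean_gap_nonneg[of t] by (simp add: X_0 del: fedavg.simps)
next
  case (Suc l)
  define \<delta> where "\<delta> = (\<integral>\<omega>. (norm (X i t l \<omega> - x t \<omega>))\<^sup>2 \<partial>M)"
  define W where "W = mean_gap t + 1"
  have "0 \<le> W" unfolding W_def using mean_gap_nonneg[of t] by simp
  have "0 \<le> \<delta>" unfolding \<delta>_def by (simp add: Bochner_Integration.integral_nonneg)
  have X: "square_integrable M (X i t l)" and IH: "\<delta> \<le> (2 * growth) ^ l * ((\<alpha> t)\<^sup>2 * W)"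
    using Suc unfolding \<delta>_def W_def by auto
  have "l < Q" using Suc.prems by simp
  note G = stoch_grad_moment[OF i this x X, folded \<delta>_def]
  have diff: "square_integrable M (\<lambda>\<omega>. X i t l \<omega> - x t \<omega>)"
    using X x by (rule square_integrable_diff)
  have sG: "square_integrable M (\<lambda>\<omega>. (- \<alpha> t) *\<^sub>R G i t l \<omega>)"
    using G(1) by (rule square_integrable_scaleR)
  have eq: "X i t (Suc l) \<omega> - x t \<omega> = (X i t l \<omega> - x t \<omega>) + (- \<alpha> t) *\<^sub>R G i t l \<omega>" for \<omega>
    by (simp add: X_Suc)
  have X': "square_integrable M (X i t (Suc l))"
    using square_integrable_add[OF X sG] by (simp add: X_Suc[abs_def])
  have "(\<integral>\<omega>. (norm (X i t (Suc l) \<omega> - x t \<omega>))\<^sup>2 \<partial>M)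
      \<le> (\<integral>\<omega>. 2 * (norm (X i t l \<omega> - x t \<omega>))\<^sup>2 + 2 * (norm ((- \<alpha> t) *\<^sub>R G i t l \<omega>))\<^sup>2 \<partial>M)"
    unfolding eq using square_integrableD[OF diff] square_integrableD[OF sG]
    by (intro integral_mono norm_add_sq_le square_integrableD square_integrable_add diff sG) auto
  also have "\<dots> = 2 * \<delta> + 2 * (\<alpha> t)\<^sup>2 * (\<integral>\<omega>. (norm (G i t l \<omega>))\<^sup>2 \<partial>M)"
    unfolding \<delta>_def using square_integrableD[OF diff] square_integrableD[OF G(1)]
    by (simp add: power_mult_distrib)
  also have "\<dots> \<le> 2 * \<delta> + 2 * (\<alpha> t)\<^sup>2 * (grad_const * (W + \<delta>))"
    using G(2) unfolding W_def by (intro add_left_mono mult_left_mono) auto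
  also have "\<dots> = (2 + 2 * ((\<alpha> t)\<^sup>2 * grad_const)) * \<delta> + (2 * grad_const) * ((\<alpha> t)\<^sup>2 * W)"
    by (simp add: algebra_simps)
  also have "\<dots> \<le> growth * \<delta> + growth * ((\<alpha> t)\<^sup>2 * W)"
  proof (intro add_mono mult_right_mono)
    have "(\<alpha> t)\<^sup>2 * grad_const \<le> step_const * grad_const"
      using step_sq_le grad_const_nonneg by (intro mult_right_mono) auto
    then show "2 + 2 * ((\<alpha> t)\<^sup>2 * grad_const) \<le> growth"
      unfolding growth_def using grad_const_nonneg by linarith
    have "0 \<le> step_const * grad_const"
      using order_trans[OF zero_le_power2 step_sq_le] grad_const_nonneg by simp
    then show "2 * grad_const \<le> growth" unfolding growth_def by linarith
  qed (use \<open>0 \<le> \<delta>\<close> \<open>0 \<le> W\<close> in auto)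
  also have "\<dots> \<le> growth * ((2 * growth) ^ l * ((\<alpha> t)\<^sup>2 * W)) + growth * ((2 * growth) ^ l * ((\<alpha> t)\<^sup>2 * W))"
  proof (intro add_mono mult_left_mono IH)
    have "1 \<le> (2 * growth) ^ l" using growth_ge by (intro one_le_power) simp
    then have "1 * ((\<alpha> t)\<^sup>2 * W) \<le> (2 * growth) ^ l * ((\<alpha> t)\<^sup>2 * W)"
      using \<open>0 \<le> W\<close> by (intro mult_right_mono) auto
    then show "(\<alpha> t)\<^sup>2 * W \<le> (2 * growth) ^ l * ((\<alpha> t)\<^sup>2 * W)" by simp
  qed (use growth_ge in auto)
  also have "\<dots> = (2 * growth) ^ Suc l * ((\<alpha> t)\<^sup>2 * W)" by simp
  finally show ?case using X' unfolding W_def by blast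
qed

lemma x_square_integrable: "square_integrable M (x t)"
proof (induction t)
  case 0
  have "x 0 = (\<lambda>\<omega>. x0)" by auto
  then show ?case using square_integrable_const by simp
next
  case (Suc t)
  have "x (Suc t) = (\<lambda>\<omega>. (1 / real n) *\<^sub>R (\<Sum>i = 1..n. X i t Q \<omega>))"
    by (rule ext) (rule x_Suc)
  then show ?case
    using displacement_moment[OF _ order_refl Suc]
    by (simp only:) (intro square_integrable_scaleR square_integrable_sum; blast)
qed

lemma X_square_integrable: "i \<in> {1..n} \<Longrightarrow> l \<le> Q \<Longrightarrow> square_integrable M (X i t l)"
  using displacement_moment[OF _ _ x_square_integrable] by blast

lemma noise_square_integrable: "i \<in> {1..n} \<Longrightarrow> l < Q \<Longrightarrow> square_integrable M (noise i t l)"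
  by (intro noise_moment(1) X_square_integrable) auto

text \<open>The sum of the constants for displacement and noise, so that one constant serves for both.\<close>

definition moment_const :: real where
  "moment_const = (2 * growth) ^ Q + grad_const * (1 + (2 * growth) ^ Q * step_const)"

lemma moment_const_bounds:
  "0 \<le> moment_const" "(2 * growth) ^ Q \<le> moment_const"
  "grad_const * (1 + (2 * growth) ^ Q * step_const) \<le> moment_const"
proof -
  have "0 \<le> (2 * growth) ^ Q" using growth_ge by simp
  moreover have "0 \<le> step_const" using order_trans[OF zero_le_power2 step_sq_le] .
  ultimately have "0 \<le> grad_const * (1 + (2 * growth) ^ Q * step_const)"
    using grad_const_nonneg by simp
  with \<open>0 \<le> (2 * growth) ^ Q\<close> show "0 \<le> moment_const" "(2 * growth) ^ Q \<le> moment_const"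
    "grad_const * (1 + (2 * growth) ^ Q * step_const) \<le> moment_const"
    unfolding moment_const_def by linarith+
qed

lemma displacement_le:
  assumes "i \<in> {1..n}" "l \<le> Q"
  shows "(\<integral>\<omega>. (norm (X i t l \<omega> - x t \<omega>))\<^sup>2 \<partial>M) \<le> (2 * growth) ^ Q * ((\<alpha> t)\<^sup>2 * (mean_gap t + 1))"
proof -
  have "(\<integral>\<omega>. (norm (X i t l \<omega> - x t \<omega>))\<^sup>2 \<partial>M) \<le> (2 * growth) ^ l * ((\<alpha> t)\<^sup>2 * (mean_gap t + 1))"
    using displacement_moment[OF assms x_square_integrable] by blast
  also have "\<dots> \<le> (2 * growth) ^ Q * ((\<alpha> t)\<^sup>2 * (mean_gap t + 1))"
    using growth_ge mean_gap_nonneg[of t] assms(2)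
    by (intro mult_right_mono power_increasing) auto
  finally show ?thesis .
qed

lemma displacement_bound:
  assumes "i \<in> {1..n}" "l \<le> Q"
  shows "(\<integral>\<omega>. (norm (X i t l \<omega> - x t \<omega>))\<^sup>2 \<partial>M) \<le> moment_const * ((\<alpha> t)\<^sup>2 * (mean_gap t + 1))"
  by (rule order_trans[OF displacement_le[OF assms]])
    (use moment_const_bounds mean_gap_nonneg[of t] in \<open>intro mult_right_mono; simp\<close>)

lemma noise_bound:
  assumes "i \<in> {1..n}" "l < Q"
  shows "(\<integral>\<omega>. (norm (noise i t l \<omega>))\<^sup>2 \<partial>M) \<le> moment_const * (mean_gap t + 1)"
proof -
  define W where "W = mean_gap t + 1"
  have "0 \<le> W" unfolding W_def using mean_gap_nonneg[of t] by simp
  define \<delta> where "\<delta> = (\<integral>\<omega>. (norm (X i t l \<omega> - x t \<omega>))\<^sup>2 \<partial>M)"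
  have "\<delta> \<le> (2 * growth) ^ Q * ((\<alpha> t)\<^sup>2 * W)"
    using displacement_le[of i l t] assms unfolding \<delta>_def W_def by simp
  also have "\<dots> \<le> (2 * growth) ^ Q * (step_const * W)"
    using growth_ge \<open>0 \<le> W\<close> step_sq_le by (intro mult_left_mono mult_right_mono) auto
  finally have "grad_const * (W + \<delta>) \<le> grad_const * (W + (2 * growth) ^ Q * (step_const * W))"
    using grad_const_nonneg by (intro mult_left_mono add_left_mono) auto
  also have "\<dots> = grad_const * (1 + (2 * growth) ^ Q * step_const) * W"
    by (simp add: algebra_simps)
  also have "\<dots> \<le> moment_const * W"
    using moment_const_bounds \<open>0 \<le> W\<close> by (intro mult_right_mono) auto
  finally have "grad_const * (W + \<delta>) \<le> moment_const * W" .
  then show ?thesis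
    using stoch_grad_moment(3)[OF assms x_square_integrable X_square_integrable, of t] assms
    unfolding W_def \<delta>_def by simp
qed

section \<open>One round as a perturbed gradient step\<close>

text \<open>The gradients are evaluated at the local iterates instead of \<open>x t\<close>. The resulting error is the
  only bias of a round with respect to a gradient step of length \<open>\<alpha> t * Q\<close> on \<open>favg\<close>.\<close>

definition drift_error :: "nat \<Rightarrow> 'w \<Rightarrow> real ^ 'p" where
  "drift_error t \<omega> = (1 / real n) *\<^sub>R
     (\<Sum>i = 1..n. \<Sum>l<Q. gradient (f i) (x t \<omega>) - gradient (f i) (X i t l \<omega>))"

definition round_noise :: "nat \<Rightarrow> 'w \<Rightarrow> real ^ 'p" where
  "round_noise t \<omega> = (- \<alpha> t) *\<^sub>R ((1 / real n) *\<^sub>R (\<Sum>i = 1..n. \<Sum>l<Q. noise i t l \<omega>))"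

lemma gradient_favg: "gradient favg y = (1 / real n) *\<^sub>R (\<Sum>i = 1..n. gradient (f i) y)"
  by (rule avg_fun_gradient(2)[OF smooth])

lemma round_decomposition:
  "x (Suc t) \<omega> = x t \<omega> + \<alpha> t *\<^sub>R (drift_error t \<omega> - real Q *\<^sub>R gradient favg (x t \<omega>)) + round_noise t \<omega>"
proof -
  define S where "S = (\<Sum>i = 1..n. \<Sum>l<Q. G i t l \<omega>)"
  have "(\<Sum>i = 1..n. X i t Q \<omega>) = real n *\<^sub>R x t \<omega> - \<alpha> t *\<^sub>R S"
    unfolding X_eq S_def sum_subtractf scaleR_sum_right[symmetric] by (simp add: sum_constant_scaleR del: sum_constant)
  then have "x (Suc t) \<omega> = x t \<omega> - \<alpha> t *\<^sub>R ((1 / real n) *\<^sub>R S)"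
    unfolding x_Suc using n by (simp add: scaleR_diff_right)
  moreover have "(1 / real n) *\<^sub>R S = (1 / real n) *\<^sub>R (\<Sum>i = 1..n. \<Sum>l<Q. noise i t l \<omega>)
      + real Q *\<^sub>R gradient favg (x t \<omega>) - drift_error t \<omega>"
  proof -
    have "real Q *\<^sub>R gradient favg (x t \<omega>)
        = (1 / real n) *\<^sub>R (\<Sum>i = 1..n. \<Sum>l<Q. gradient (f i) (x t \<omega>))"
      unfolding gradient_favg by (simp add: sum_constant_scaleR scaleR_sum_right mult.commute del: sum_constant)
    then show ?thesis
      unfolding S_def drift_error_def G_eq
      by (simp only: sum.distrib sum_subtractf scaleR_add_right scaleR_diff_right)
         simp
  qed
  ultimately show ?thesis
    unfolding round_noise_def by (simp add: algebra_simps)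
qed

lemma gradient_x_square_integrable: "square_integrable M (\<lambda>\<omega>. gradient favg (x t \<omega>))"
  by (rule square_integrable_gradient[OF favg_smooth x_square_integrable])

lemma gradient_difference_moment:
  assumes i: "i \<in> {1..n}" and l: "l \<in> {..<Q}"
  shows "square_integrable M (\<lambda>\<omega>. gradient (f i) (x t \<omega>) - gradient (f i) (X i t l \<omega>))"
    and "(\<integral>\<omega>. (norm (gradient (f i) (x t \<omega>) - gradient (f i) (X i t l \<omega>)))\<^sup>2 \<partial>M)
      \<le> L\<^sup>2 * (moment_const * ((\<alpha> t)\<^sup>2 * (mean_gap t + 1)))"
proof -
  have l': "l \<le> Q" using l by simp
  note X = X_square_integrable[OF i l', of t]
  show si: "square_integrable M (\<lambda>\<omega>. gradient (f i) (x t \<omega>) - gradient (f i) (X i t l \<omega>))"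
    by (intro square_integrable_diff square_integrable_gradient[OF smooth[OF i]]
        x_square_integrable X)
  have disp: "integrable M (\<lambda>\<omega>. (norm (X i t l \<omega> - x t \<omega>))\<^sup>2)"
    by (intro square_integrableD square_integrable_diff X x_square_integrable)
  have "(\<integral>\<omega>. (norm (gradient (f i) (x t \<omega>) - gradient (f i) (X i t l \<omega>)))\<^sup>2 \<partial>M)
      \<le> (\<integral>\<omega>. L\<^sup>2 * (norm (X i t l \<omega> - x t \<omega>))\<^sup>2 \<partial>M)"
  proof (rule integral_mono[OF square_integrableD[OF si] integrable_mult_right[OF disp]])
    fix \<omega>
    have "(norm (gradient (f i) (x t \<omega>) - gradient (f i) (X i t l \<omega>)))\<^sup>2 \<le> (L * norm (x t \<omega> - X i t l \<omega>))\<^sup>2"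
      by (intro power_mono L_smoothD(2)[OF smooth[OF i]]) simp
    then show "(norm (gradient (f i) (x t \<omega>) - gradient (f i) (X i t l \<omega>)))\<^sup>2
        \<le> L\<^sup>2 * (norm (X i t l \<omega> - x t \<omega>))\<^sup>2"
      by (simp add: power_mult_distrib norm_minus_commute)
  qed
  also have "\<dots> = L\<^sup>2 * (\<integral>\<omega>. (norm (X i t l \<omega> - x t \<omega>))\<^sup>2 \<partial>M)" by simp
  also have "\<dots> \<le> L\<^sup>2 * (moment_const * ((\<alpha> t)\<^sup>2 * (mean_gap t + 1)))"
    by (intro mult_left_mono displacement_bound[OF i l']) simp
  finally show "(\<integral>\<omega>. (norm (gradient (f i) (x t \<omega>) - gradient (f i) (X i t l \<omega>)))\<^sup>2 \<partial>M)
      \<le> L\<^sup>2 * (moment_const * ((\<alpha> t)\<^sup>2 * (mean_gap t + 1)))" .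
qed

lemma drift_error_moment:
  shows "square_integrable M (drift_error t)"
    and "(\<integral>\<omega>. (norm (drift_error t \<omega>))\<^sup>2 \<partial>M)
      \<le> (real Q)\<^sup>2 * L\<^sup>2 * moment_const * ((\<alpha> t)\<^sup>2 * (mean_gap t + 1))"
proof -
  show "square_integrable M (drift_error t)"
    unfolding drift_error_def[abs_def]
    by (intro square_integrable_scaleR square_integrable_sum gradient_difference_moment(1))
  have "(\<integral>\<omega>. (norm (drift_error t \<omega>))\<^sup>2 \<partial>M)
      \<le> (real (card {..<Q}))\<^sup>2 * (L\<^sup>2 * (moment_const * ((\<alpha> t)\<^sup>2 * (mean_gap t + 1))))"
    unfolding drift_error_def
    by (rule second_moment_average_le[OF n])
      (intro square_integrable_sum second_moment_sum_le gradient_difference_moment; assumption)+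
  then show "(\<integral>\<omega>. (norm (drift_error t \<omega>))\<^sup>2 \<partial>M)
      \<le> (real Q)\<^sup>2 * L\<^sup>2 * moment_const * ((\<alpha> t)\<^sup>2 * (mean_gap t + 1))"
    by (simp add: mult.assoc)
qed

lemma round_noise_moment:
  shows "square_integrable M (round_noise t)"
    and "(\<integral>\<omega>. (norm (round_noise t \<omega>))\<^sup>2 \<partial>M)
      \<le> (real Q)\<^sup>2 * moment_const * ((\<alpha> t)\<^sup>2 * (mean_gap t + 1))"
proof -
  have noise: "square_integrable M (noise i t l)"
    "(\<integral>\<omega>. (norm (noise i t l \<omega>))\<^sup>2 \<partial>M) \<le> moment_const * (mean_gap t + 1)"
    if "i \<in> {1..n}" "l \<in> {..<Q}" for i l
    using that by (simp_all add: noise_square_integrable noise_bound)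
  define S where "S \<omega> = (1 / real n) *\<^sub>R (\<Sum>i = 1..n. \<Sum>l<Q. noise i t l \<omega>)" for \<omega>
  have S: "square_integrable M S"
    unfolding S_def[abs_def] by (intro square_integrable_scaleR square_integrable_sum noise(1))
  have eq: "round_noise t = (\<lambda>\<omega>. (- \<alpha> t) *\<^sub>R S \<omega>)"
    unfolding round_noise_def[abs_def] S_def by (rule refl)
  show "square_integrable M (round_noise t)"
    unfolding eq by (rule square_integrable_scaleR[OF S])
  have "(\<integral>\<omega>. (norm (S \<omega>))\<^sup>2 \<partial>M) \<le> (real (card {..<Q}))\<^sup>2 * (moment_const * (mean_gap t + 1))"
    unfolding S_def
    by (rule second_moment_average_le[OF n])
      (intro square_integrable_sum second_moment_sum_le noise; assumption)+
  then have "(\<alpha> t)\<^sup>2 * (\<integral>\<omega>. (norm (S \<omega>))\<^sup>2 \<partial>M)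
      \<le> (\<alpha> t)\<^sup>2 * ((real Q)\<^sup>2 * (moment_const * (mean_gap t + 1)))"
    by (intro mult_left_mono) simp_all
  then show "(\<integral>\<omega>. (norm (round_noise t \<omega>))\<^sup>2 \<partial>M)
      \<le> (real Q)\<^sup>2 * moment_const * ((\<alpha> t)\<^sup>2 * (mean_gap t + 1))"
    unfolding eq by (simp add: power_mult_distrib mult_ac)
qed

text \<open>The noise of step \<open>l\<close> is centred given \<open>F t l\<close>, which contains \<open>F t 0\<close>; so every term is
  orthogonal to what is known at the start of the round.\<close>

lemma round_noise_orthogonal:
  assumes Z: "Z \<in> borel_measurable (F t 0)" "square_integrable M Z"
  shows "(\<integral>\<omega>. Z \<omega> \<bullet> round_noise t \<omega> \<partial>M) = 0"
proof -
  have zero: "(\<integral>\<omega>. Z \<omega> \<bullet> noise i t l \<omega> \<partial>M) = 0" if i: "i \<in> {1..n}" and l: "l < Q" for i l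
    unfolding noise_def
  proof (rule expectation_inner_cond_centred[OF sub[OF l]])
    show "square_integrable M (G i t l)"
      using stoch_grad_moment(1)[OF i l x_square_integrable X_square_integrable] i l by simp
    show "square_integrable M (\<lambda>\<omega>. gradient (f i) (X i t l \<omega>))"
      using square_integrable_gradient[OF smooth[OF i] X_square_integrable] i l by simp
    show "Z \<in> borel_measurable (F t l)"
      by (rule measurable_from_subalg[OF sub_within_round[OF le0 l] Z(1)])
    show "AE \<omega> in M. vec_cond_exp M (F t l) (G i t l) \<omega> = gradient (f i) (X i t l \<omega>)"
      using abc_iterate[OF i l] unfolding abc_at_def by blast
  qed (rule Z(2))
  have "(\<integral>\<omega>. (\<Sum>i = 1..n. \<Sum>l<Q. Z \<omega> \<bullet> noise i t l \<omega>) \<partial>M)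
      = (\<Sum>i = 1..n. \<integral>\<omega>. (\<Sum>l<Q. Z \<omega> \<bullet> noise i t l \<omega>) \<partial>M)"
    by (rule Bochner_Integration.integral_sum)
      (intro Bochner_Integration.integrable_sum integrable_inner[OF Z(2)] noise_square_integrable; simp)
  also have "\<dots> = (\<Sum>i = 1..n. \<Sum>l<Q. \<integral>\<omega>. Z \<omega> \<bullet> noise i t l \<omega> \<partial>M)"
    by (intro sum.cong refl Bochner_Integration.integral_sum integrable_inner[OF Z(2)]
        noise_square_integrable; simp)
  also have "\<dots> = 0" using zero by simp
  finally show ?thesis
    unfolding round_noise_def by (simp add: inner_sum_right)
qed

text \<open>Adaptedness is the delicate point: a stochastic gradient of the last local step is only known
  to be measurable with respect to \<open>F (Suc t) (Q - 1)\<close>, which may be larger than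
  \<open>F (Suc t) 0\<close>. The total noise of the round can be read off from \<open>x (Suc t)\<close> by the
  decomposition of the round, and is therefore known at the start of the next one.\<close>

lemma martingale_round_noise: "martingale_differences M (\<lambda>t. F t 0) round_noise"
proof unfold_locales
  fix t
  show "subalgebra M (F t 0)" using sub[of 0 t] Q by simp
  show "subalgebra (F (Suc t) 0) (F t 0)" using sub_next_round[of 0 t] Q by simp
  show "square_integrable M (round_noise t)" by (rule round_noise_moment(1))
  have meas: "(\<lambda>\<omega>. gradient \<phi> (Y \<omega>)) \<in> borel_measurable N"
    if "L_smooth L \<phi>" "Y \<in> borel_measurable N" for \<phi> :: "real ^ 'p \<Rightarrow> real" and Y and N :: "'w measure"
    using measurable_compose[OF that(2) borel_measurable_continuous_onI[OF continuous_gradient[OF that(1)]]] .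
  have x: "x t \<in> borel_measurable (F (Suc t) 0)"
    using Q by (intro measurable_from_subalg[OF sub_next_round x_measurable]) simp
  have drift: "drift_error t \<in> borel_measurable (F (Suc t) 0)"
    unfolding drift_error_def[abs_def]
  proof (intro borel_measurable_scaleR borel_measurable_const borel_measurable_sum borel_measurable_diff)
    fix i l assume i: "i \<in> {1..n}" and l: "l \<in> {..<Q}"
    show "(\<lambda>\<omega>. gradient (f i) (x t \<omega>)) \<in> borel_measurable (F (Suc t) 0)"
      by (rule meas[OF smooth[OF i] x])
    have "X i t l \<in> borel_measurable (F (Suc t) 0)"
      using l by (intro measurable_from_subalg[OF sub_next_round X_measurable[OF i]]) simp_all
    then show "(\<lambda>\<omega>. gradient (f i) (X i t l \<omega>)) \<in> borel_measurable (F (Suc t) 0)"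
      by (rule meas[OF smooth[OF i]])
  qed
  have eq: "round_noise t = (\<lambda>\<omega>. x (Suc t) \<omega> - x t \<omega>
      - \<alpha> t *\<^sub>R (drift_error t \<omega> - real Q *\<^sub>R gradient favg (x t \<omega>)))"
    by (rule ext) (simp only: round_decomposition, simp)
  show "round_noise t \<in> borel_measurable (F (Suc t) 0)"
    unfolding eq
    by (intro borel_measurable_diff borel_measurable_scaleR borel_measurable_const
        x_measurable x drift meas[OF favg_smooth])
qed (rule round_noise_orthogonal)

lemma gradient_sq_le_gap: "(norm (gradient favg y))\<^sup>2 \<le> 2 * L * (favg y - lower_val)"
  by (rule norm_gradient_sq_le_gap[OF favg_smooth L lower_val_le])

definition mean_grad_sq :: "nat \<Rightarrow> real" where
  "mean_grad_sq t = (\<integral>\<omega>. (norm (gradient favg (x t \<omega>)))\<^sup>2 \<partial>M)"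

lemma mean_grad_sq_nonneg: "0 \<le> mean_grad_sq t"
  unfolding mean_grad_sq_def by (rule Bochner_Integration.integral_nonneg) simp

lemma mean_grad_sq_le: "mean_grad_sq t \<le> 2 * L * mean_gap t"
proof -
  have "mean_grad_sq t \<le> (\<integral>\<omega>. 2 * L * (favg (x t \<omega>) - lower_val) \<partial>M)"
    unfolding mean_grad_sq_def
    by (intro integral_mono square_integrableD gradient_x_square_integrable integrable_mult_right
        integrable_gap x_square_integrable gradient_sq_le_gap)
  then show ?thesis unfolding mean_gap_def by simp
qed

definition descent_const :: real where
  "descent_const = (real Q)\<^sup>2 * L\<^sup>2 * moment_const / 2 + L + L * moment_const / 2"

lemma descent_const_nonneg: "0 \<le> descent_const"
  unfolding descent_const_def using L moment_const_bounds(1) by simp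

text \<open>The descent lemma for \<open>favg\<close>, averaged. The noise drops out by orthogonality. The drift error
  enters through its product with the gradient, which is split so that both resulting squares carry
  the factor \<open>(\<alpha> t)\<^sup>2\<close>; the squared gradient is then absorbed into the gap. All errors are
  thus of order \<open>(\<alpha> t)\<^sup>2\<close>.\<close>

lemma mean_gap_step:
  "mean_gap (Suc t) \<le> mean_gap t - \<alpha> t * real Q * mean_grad_sq t
     + descent_const * ((\<alpha> t)\<^sup>2 * (mean_gap t + 1))"
proof -
  define W where "W = (\<alpha> t)\<^sup>2 * (mean_gap t + 1)"
  define \<Delta> where "\<Delta> \<omega> = x (Suc t) \<omega> - x t \<omega>" for \<omega>
  define d where "d \<omega> = gradient favg (x t \<omega>)" for \<omega>
  have d: "square_integrable M d" unfolding d_def by (rule gradient_x_square_integrable)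
  have \<Delta>: "square_integrable M \<Delta>"
    unfolding \<Delta>_def[abs_def] by (intro square_integrable_diff x_square_integrable)
  have \<Delta>_eq: "\<Delta> \<omega> = (1 / real n) *\<^sub>R (\<Sum>i = 1..n. X i t Q \<omega> - x t \<omega>)" for \<omega>
    unfolding \<Delta>_def x_Suc using n
    by (simp add: sum_subtractf sum_constant_scaleR scaleR_diff_right del: sum_constant)
  have \<Delta>_bound: "(\<integral>\<omega>. (norm (\<Delta> \<omega>))\<^sup>2 \<partial>M) \<le> moment_const * W"
    unfolding \<Delta>_eq W_def
    by (rule second_moment_average_le[OF n])
      (intro square_integrable_diff X_square_integrable x_square_integrable displacement_bound;
       simp)+
  have int: "integrable M (\<lambda>\<omega>. (norm (drift_error t \<omega>))\<^sup>2)" "integrable M (\<lambda>\<omega>. (norm (d \<omega>))\<^sup>2)"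
    "integrable M (\<lambda>\<omega>. d \<omega> \<bullet> round_noise t \<omega>)" "integrable M (\<lambda>\<omega>. (norm (\<Delta> \<omega>))\<^sup>2)"
    "integrable M (\<lambda>\<omega>. favg (x t \<omega>) - lower_val)"
    by (intro square_integrableD drift_error_moment d integrable_inner round_noise_moment \<Delta>
        integrable_gap x_square_integrable)+
  have "d \<in> borel_measurable (F t 0)"
    unfolding d_def
    by (rule measurable_compose[OF x_measurable
          borel_measurable_continuous_onI[OF continuous_gradient[OF favg_smooth]]])
  then have orth: "(\<integral>\<omega>. d \<omega> \<bullet> round_noise t \<omega> \<partial>M) = 0"
    using d by (rule round_noise_orthogonal)
  have pointwise: "favg (x (Suc t) \<omega>) - lower_val
      \<le> (favg (x t \<omega>) - lower_val) + (1 / 2) * (norm (drift_error t \<omega>))\<^sup>2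
        + ((\<alpha> t)\<^sup>2 / 2 - \<alpha> t * real Q) * (norm (d \<omega>))\<^sup>2 + d \<omega> \<bullet> round_noise t \<omega>
        + (L / 2) * (norm (\<Delta> \<omega>))\<^sup>2" for \<omega>
  proof -
    have "favg (x (Suc t) \<omega>) \<le> favg (x t \<omega>) + \<Delta> \<omega> \<bullet> d \<omega> + L / 2 * (norm (\<Delta> \<omega>))\<^sup>2"
      unfolding \<Delta>_def d_def by (rule L_smooth_upper_bound[OF favg_smooth])
    moreover have \<Delta>_split: "\<Delta> \<omega> = \<alpha> t *\<^sub>R (drift_error t \<omega> - real Q *\<^sub>R d \<omega>) + round_noise t \<omega>"
      unfolding \<Delta>_def d_def by (simp only: round_decomposition) simp
    have "\<Delta> \<omega> \<bullet> d \<omega> = drift_error t \<omega> \<bullet> (\<alpha> t *\<^sub>R d \<omega>) - \<alpha> t * real Q * (norm (d \<omega>))\<^sup>2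
        + d \<omega> \<bullet> round_noise t \<omega>"
      unfolding \<Delta>_split
      by (simp add: inner_add_left inner_diff_left power2_norm_eq_inner right_diff_distrib inner_commute[of "round_noise t \<omega>"])
    \<comment> \<open>The factor \<open>\<alpha> t\<close> goes to the gradient only: the drift error is already of order \<open>\<alpha> t\<close>.\<close>
    moreover have "drift_error t \<omega> \<bullet> (\<alpha> t *\<^sub>R d \<omega>)
        \<le> (norm (drift_error t \<omega>))\<^sup>2 / 2 + (\<alpha> t)\<^sup>2 * (norm (d \<omega>))\<^sup>2 / 2"
      using inner_le_half_squares[of "drift_error t \<omega>" "\<alpha> t *\<^sub>R d \<omega>"] by (simp add: power_mult_distrib)
    ultimately show ?thesis by (simp add: algebra_simps)
  qed
  have "mean_gap (Suc t) \<le> (\<integral>\<omega>. (favg (x t \<omega>) - lower_val) + (1 / 2) * (norm (drift_error t \<omega>))\<^sup>2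
        + ((\<alpha> t)\<^sup>2 / 2 - \<alpha> t * real Q) * (norm (d \<omega>))\<^sup>2 + d \<omega> \<bullet> round_noise t \<omega>
        + (L / 2) * (norm (\<Delta> \<omega>))\<^sup>2 \<partial>M)"
    unfolding mean_gap_def
    by (intro integral_mono integrable_gap x_square_integrable pointwise
        Bochner_Integration.integrable_add integrable_mult_right int)
  also have "\<dots> = mean_gap t + (1 / 2) * (\<integral>\<omega>. (norm (drift_error t \<omega>))\<^sup>2 \<partial>M)
      + ((\<alpha> t)\<^sup>2 / 2 - \<alpha> t * real Q) * mean_grad_sq t + (L / 2) * (\<integral>\<omega>. (norm (\<Delta> \<omega>))\<^sup>2 \<partial>M)"
    unfolding mean_gap_def mean_grad_sq_def d_def[symmetric]
    by (simp only: Bochner_Integration.integral_add Bochner_Integration.integrable_add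
        integrable_mult_right int integral_mult_right_zero orth)
  also have "\<dots> \<le> mean_gap t + (1 / 2) * ((real Q)\<^sup>2 * L\<^sup>2 * moment_const * W)
      + ((\<alpha> t)\<^sup>2 / 2 - \<alpha> t * real Q) * mean_grad_sq t + (L / 2) * (moment_const * W)"
    using drift_error_moment(2)[of t] \<Delta>_bound L unfolding W_def[symmetric]
    by (intro add_mono mult_left_mono order_refl) simp_all
  also have "\<dots> \<le> mean_gap t - \<alpha> t * real Q * mean_grad_sq t + descent_const * W"
  proof -
    have "(\<alpha> t)\<^sup>2 / 2 * mean_grad_sq t \<le> (\<alpha> t)\<^sup>2 / 2 * (2 * L * (mean_gap t + 1))"
      using mean_grad_sq_le[of t] L by (intro mult_left_mono) (simp_all add: algebra_simps)
    also have "\<dots> = L * W" unfolding W_def by simp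
    finally show ?thesis unfolding descent_const_def by (simp add: algebra_simps)
  qed
  finally show ?thesis unfolding W_def .
qed

section \<open>Convergence\<close>

lemma mean_gap_bounded_and_summable:
  obtains B where "\<And>t. mean_gap t + 1 \<le> B" "summable (\<lambda>t. \<alpha> t * mean_grad_sq t)"
proof -
  define b where "b t = \<alpha> t * real Q * mean_grad_sq t" for t
  obtain B where B: "\<And>t. mean_gap t + 1 \<le> B" "summable b"
  proof (rule perturbed_decrease[of "\<lambda>t. mean_gap t + 1" b "\<lambda>t. descent_const * (\<alpha> t)\<^sup>2"])
    show "0 \<le> mean_gap t + 1" for t using mean_gap_nonneg[of t] by simp
    show "0 \<le> b t" for t
      unfolding b_def using pos[of t] mean_grad_sq_nonneg[of t] by simp
    show "0 \<le> descent_const * (\<alpha> t)\<^sup>2" for t using descent_const_nonneg by simp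
    show "summable (\<lambda>t. descent_const * (\<alpha> t)\<^sup>2)" by (rule summable_mult[OF sq])
    show "mean_gap (Suc t) + 1 \<le> (1 + descent_const * (\<alpha> t)\<^sup>2) * (mean_gap t + 1) - b t" for t
      using mean_gap_step[of t] unfolding b_def by (simp add: algebra_simps)
  qed blast
  have "(\<lambda>t. \<alpha> t * mean_grad_sq t) = (\<lambda>t. (1 / real Q) * b t)"
    unfolding b_def using Q by auto
  then have "summable (\<lambda>t. \<alpha> t * mean_grad_sq t)"
    using summable_mult[OF B(2), of "1 / real Q"] by (simp only:)
  with B(1) show thesis by (rule that)
qed

lemma summable_of_step_sq_bound:
  assumes "\<And>t. mean_gap t + 1 \<le> B" "0 \<le> c" "\<And>t. 0 \<le> a t"
    and "\<And>t. a t \<le> c * ((\<alpha> t)\<^sup>2 * (mean_gap t + 1))"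
  shows "summable a"
proof (rule summable_comparison_test'[OF summable_mult[OF sq, of "c * B"]])
  fix t :: nat
  have "c * ((\<alpha> t)\<^sup>2 * (mean_gap t + 1)) \<le> c * ((\<alpha> t)\<^sup>2 * B)"
    using assms(1,2) by (intro mult_left_mono) simp_all
  with assms(3,4)[of t] show "norm (a t) \<le> c * B * (\<alpha> t)\<^sup>2" by (simp add: mult_ac)
qed

text \<open>Along almost every path the weighted squared gradients are summable, the noise forms a
  convergent series, and the drift errors are square summable. These are the inputs of \<open>tendsto_zero_if_no_late_excursion\<close>.\<close>

theorem AE_gradient_tendsto_zero:
  assumes div: "\<not> summable \<alpha>"
  shows "AE \<omega> in M. (\<lambda>t. norm (gradient favg (x t \<omega>))) \<longlonglongrightarrow> 0"
proof -
  interpret noise: martingale_differences M "\<lambda>t. F t 0" round_noise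
    by (rule martingale_round_noise)
  obtain B where B: "\<And>t. mean_gap t + 1 \<le> B" and sum_grad: "summable (\<lambda>t. \<alpha> t * mean_grad_sq t)"
    using mean_gap_bounded_and_summable by blast
  have "summable (\<lambda>t. \<integral>\<omega>. (norm (round_noise t \<omega>))\<^sup>2 \<partial>M)"
    by (rule summable_of_step_sq_bound[OF B _ _ round_noise_moment(2)])
      (simp_all add: moment_const_bounds(1) Bochner_Integration.integral_nonneg)
  then have noise: "AE \<omega> in M. convergent (\<lambda>T. \<Sum>t<T. round_noise t \<omega>)"
    by (rule noise.AE_convergent_sum)
  have "summable (\<lambda>t. \<integral>\<omega>. (norm (drift_error t \<omega>))\<^sup>2 \<partial>M)"
    by (rule summable_of_step_sq_bound[OF B _ _ drift_error_moment(2)])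
      (simp_all add: moment_const_bounds(1) Bochner_Integration.integral_nonneg)
  then have drift: "AE \<omega> in M. summable (\<lambda>t. (norm (drift_error t \<omega>))\<^sup>2)"
    by (intro AE_summable_of_summable_integrals square_integrableD drift_error_moment(1)) simp_all
  have grad: "AE \<omega> in M. summable (\<lambda>t. \<alpha> t * (norm (gradient favg (x t \<omega>)))\<^sup>2)"
  proof (rule AE_summable_of_summable_integrals)
    show "integrable M (\<lambda>\<omega>. \<alpha> t * (norm (gradient favg (x t \<omega>)))\<^sup>2)" for t
      by (intro integrable_mult_right square_integrableD gradient_x_square_integrable)
    show "0 \<le> \<alpha> t * (norm (gradient favg (x t \<omega>)))\<^sup>2" for t \<omega>
      using pos[of t] by simp
    show "summable (\<lambda>t. \<integral>\<omega>. \<alpha> t * (norm (gradient favg (x t \<omega>)))\<^sup>2 \<partial>M)"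
      using sum_grad unfolding mean_grad_sq_def by simp
  qed
  have "(\<lambda>t. sqrt ((\<alpha> t)\<^sup>2)) \<longlonglongrightarrow> sqrt 0"
    by (rule tendsto_real_sqrt[OF summable_LIMSEQ_zero[OF sq]])
  moreover have "sqrt ((\<alpha> t)\<^sup>2) = \<alpha> t" for t using pos[of t] by simp
  ultimately have \<alpha>: "\<alpha> \<longlonglongrightarrow> 0" by simp
  from noise drift grad show ?thesis
  proof eventually_elim
    case (elim \<omega>)
    define Gr where "Gr t = norm (gradient favg (x t \<omega>))" for t
    define v where "v t = \<alpha> t *\<^sub>R (drift_error t \<omega> - real Q *\<^sub>R gradient favg (x t \<omega>))" for t
    have "Gr \<longlonglongrightarrow> 0"
    proof (rule tendsto_zero_if_no_late_excursion[where y = "\<lambda>t. x t \<omega>" and v = v and L = L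
          and m = "\<lambda>t. round_noise t \<omega>" and \<rho> = "\<lambda>t. (\<alpha> t)\<^sup>2 + (norm (drift_error t \<omega>))\<^sup>2"])
      show "0 \<le> Gr t" for t unfolding Gr_def by simp
      show "0 \<le> \<alpha> t" for t using pos[of t] by simp
      show "\<alpha> \<longlonglongrightarrow> 0" by (rule \<alpha>)
      show "\<not> summable \<alpha>" by (rule div)
      show "0 < L" by (rule L)
      show "\<bar>Gr s - Gr t\<bar> \<le> L * norm (x s \<omega> - x t \<omega>)" for s t
        unfolding Gr_def by (rule order_trans[OF norm_triangle_ineq3 L_smoothD(2)[OF favg_smooth]])
      show "x (Suc t) \<omega> = x t \<omega> + v t + round_noise t \<omega>" for t
        unfolding v_def by (rule round_decomposition)
      show "convergent (\<lambda>T. \<Sum>t<T. round_noise t \<omega>)" by (rule elim(1))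
      show "0 < real Q" using Q by simp
      show "summable (\<lambda>t. (\<alpha> t)\<^sup>2 + (norm (drift_error t \<omega>))\<^sup>2)"
        by (rule summable_add[OF sq elim(2)])
      show "summable (\<lambda>t. \<alpha> t * (Gr t)\<^sup>2)" unfolding Gr_def by (rule elim(3))
      fix t
      have "norm (v t) \<le> \<alpha> t * (norm (drift_error t \<omega>) + real Q * Gr t)"
        unfolding v_def Gr_def using pos[of t]
          norm_triangle_ineq4[of "drift_error t \<omega>" "real Q *\<^sub>R gradient favg (x t \<omega>)"]
        by simp
      moreover have "\<alpha> t * norm (drift_error t \<omega>) \<le> (\<alpha> t)\<^sup>2 + (norm (drift_error t \<omega>))\<^sup>2"
        using sum_squares_bound[of "\<alpha> t" "norm (drift_error t \<omega>)"]
          mult_nonneg_nonneg[OF less_imp_le[OF pos[of t]] norm_ge_zero[of "drift_error t \<omega>"]]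
        by linarith
      ultimately show "norm (v t) \<le> real Q * (\<alpha> t * Gr t) + ((\<alpha> t)\<^sup>2 + (norm (drift_error t \<omega>))\<^sup>2)"
        by (simp add: algebra_simps)
    qed
    then show ?case unfolding Gr_def .
  qed
qed

lemma integrable_norm_gradient: "integrable M (\<lambda>\<omega>. norm (gradient favg (x t \<omega>)))"
  by (rule integrable_norm_of_square_integrable[OF gradient_x_square_integrable])

theorem expectation_gradient_tendsto_zero:
  assumes div: "\<not> summable \<alpha>"
  shows "(\<lambda>t. \<integral>\<omega>. norm (gradient favg (x t \<omega>)) \<partial>M) \<longlonglongrightarrow> 0"
proof -
  obtain B where B: "\<And>t. mean_gap t + 1 \<le> B"
    using mean_gap_bounded_and_summable by blast
  show ?thesis
  proof (rule expectation_tendsto_zero)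
    show "(\<lambda>\<omega>. norm (gradient favg (x t \<omega>))) \<in> borel_measurable M" for t
      by (rule borel_measurable_integrable[OF integrable_norm_gradient])
    show "integrable M (\<lambda>\<omega>. (norm (gradient favg (x t \<omega>)))\<^sup>2)" for t
      by (rule square_integrableD[OF gradient_x_square_integrable])
    show "(\<integral>\<omega>. (norm (gradient favg (x t \<omega>)))\<^sup>2 \<partial>M) \<le> 2 * L * B" for t
    proof -
      have "mean_grad_sq t \<le> 2 * L * mean_gap t" by (rule mean_grad_sq_le)
      also have "\<dots> \<le> 2 * L * B" using B[of t] L by (intro mult_left_mono) simp_all
      finally show ?thesis unfolding mean_grad_sq_def .
    qed
  qed (simp_all add: AE_gradient_tendsto_zero[OF div])
qed

end

theorem theorem2:
  fixes M :: "'w measure"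
    and F :: "nat \<Rightarrow> nat \<Rightarrow> 'w measure"
    and f :: "nat \<Rightarrow> real ^ 'p \<Rightarrow> real"
    and g :: "nat \<Rightarrow> real ^ 'p \<Rightarrow> 's \<Rightarrow> real ^ 'p"
    and \<xi> :: "nat \<Rightarrow> nat \<Rightarrow> nat \<Rightarrow> 'w \<Rightarrow> 's"
    and \<alpha> :: "nat \<Rightarrow> real"
    and x0 :: "real ^ 'p"
    and n Q :: nat
    and C D L :: real
  assumes "prob_space M"
    and "n \<ge> 1" and "Q \<ge> 1"
    and smooth: "\<And>i. i \<in> {1..n} \<Longrightarrow> L_smooth L (f i)"
    and bounded: "\<And>i. i \<in> {1..n} \<Longrightarrow> bdd_below (range (f i))"
    and abc: "ABC_assumption M F C D n Q f g \<xi> \<alpha> x0"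
    and pos: "\<And>t. \<alpha> t > 0"
    and step: "\<And>t. ereal (\<alpha> t) \<le> Min {1 / ereal C,
                                      1 / ereal (2 * real Q * L * sqrt 3),
                                      1 / ereal (2 * sqrt (2 * real Q * C * L))}"
    and div: "\<not> summable \<alpha>"
    and sq: "summable (\<lambda>t. (\<alpha> t)\<^sup>2)"
  shows "(\<forall>t. integrable M (\<lambda>\<omega>. norm (gradient (avg_fun n f) (fedavg n Q g \<xi> \<alpha> x0 t \<omega>)))) \<and>
         (\<lambda>t. \<integral>\<omega>. norm (gradient (avg_fun n f) (fedavg n Q g \<xi> \<alpha> x0 t \<omega>)) \<partial>M)
           \<longlonglongrightarrow> 0 \<and>
         (AE \<omega> in M. (\<lambda>t. norm (gradient (avg_fun n f) (fedavg n Q g \<xi> \<alpha> x0 t \<omega>)))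
           \<longlonglongrightarrow> 0)"
proof -
  interpret prob_space M by fact
  \<comment> \<open>The process needs a strictly positive smoothness constant, but \<open>L = 0\<close> is possible here
    (constant objectives).\<close>
  interpret fedavg_process M F f g \<xi> \<alpha> x0 n Q C D "max L 1"
  proof unfold_locales
    show "L_smooth (max L 1) (f i)" if "i \<in> {1..n}" for i
      by (rule L_smooth_mono[OF smooth[OF that]]) simp
    show "0 < max L 1" by simp
  qed (fact assms)+
  show ?thesis
    by (intro conjI allI integrable_norm_gradient expectation_gradient_tendsto_zero[OF div]
        AE_gradient_tendsto_zero[OF div])
qed

end
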